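(* Let $R$ be a commutative local Noetherian ring of depth $\leq 1$ and let $M$ be a finitely generated reflexive $R$-module. If $\operatorname{End}_R(M)$ has a free summand as an $R$-module, then so does $M$. Moreover, $\operatorname{End}_R(M)$ is a free $R$-module only if $M$ is a free $R$-module.
   Context: $M^*=\operatorname{Hom}_R(M,R)$. $M$ is reflexive if the evaluation map $M\to M^{**}$, $m\mapsto(\psi\mapsto\psi(m))$, is an isomorphism. "Has a free summand" means: has a nonzero free $R$-module (equivalently $R$) as a direct summand. *)

theory Defs
  imports "HOL-Algebra.Module" "HOL-Algebra.Ring_Divisibility" "HOL-Library.Extended_Nat"
begin

section \<open>Homomorphism modules and reflexivity\<close>

text \<open>
  Homomorphisms are extensional functions on the carrier, so that equality in \<open>Hom_module\<close> is
  equality of maps on the carrier. The fields \<^const>\<open>monoid.mult\<close> and \<^const>\<open>monoid.one\<close> of a module record are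
  not part of the module structure (the locale \<^locale>\<open>module\<close> does not constrain them).
\<close>

definition mod_hom ::
  "('a, 'r) ring_scheme \<Rightarrow> ('a, 'm, 'x) module_scheme \<Rightarrow> ('a, 'n, 'y) module_scheme \<Rightarrow> ('m \<Rightarrow> 'n) set"
  where "mod_hom R M N =
    {f \<in> carrier M \<rightarrow>\<^sub>E carrier N.
       (\<forall>x\<in>carrier M. \<forall>y\<in>carrier M. f (x \<oplus>\<^bsub>M\<^esub> y) = f x \<oplus>\<^bsub>N\<^esub> f y) \<and>
       (\<forall>a\<in>carrier R. \<forall>x\<in>carrier M. f (a \<odot>\<^bsub>M\<^esub> x) = a \<odot>\<^bsub>N\<^esub> f x)}"

definition mod_iso ::
  "('a, 'r) ring_scheme \<Rightarrow> ('a, 'm, 'x) module_scheme \<Rightarrow> ('a, 'n, 'y) module_scheme \<Rightarrow> ('m \<Rightarrow> 'n) set"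
  where "mod_iso R M N = {f \<in> mod_hom R M N. bij_betw f (carrier M) (carrier N)}"

definition Hom_module ::
  "('a, 'r) ring_scheme \<Rightarrow> ('a, 'm, 'x) module_scheme \<Rightarrow> ('a, 'n, 'y) module_scheme
    \<Rightarrow> ('a, 'm \<Rightarrow> 'n) module"
  where "Hom_module R M N =
    \<lparr>carrier = mod_hom R M N, monoid.mult = undefined, one = undefined,
     zero = (\<lambda>x\<in>carrier M. \<zero>\<^bsub>N\<^esub>),
     add = (\<lambda>f g. \<lambda>x\<in>carrier M. f x \<oplus>\<^bsub>N\<^esub> g x),
     smult = (\<lambda>a f. \<lambda>x\<in>carrier M. a \<odot>\<^bsub>N\<^esub> f x)\<rparr>"

abbreviation End_module ::
  "('a, 'r) ring_scheme \<Rightarrow> ('a, 'm, 'x) module_scheme \<Rightarrow> ('a, 'm \<Rightarrow> 'm) module"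
  where "End_module R M \<equiv> Hom_module R M M"

definition regular_module :: "('a, 'r) ring_scheme \<Rightarrow> ('a, 'a) module"
  where "regular_module R =
    \<lparr>carrier = carrier R, monoid.mult = monoid.mult R, one = \<one>\<^bsub>R\<^esub>, zero = \<zero>\<^bsub>R\<^esub>, add = add R, smult = monoid.mult R\<rparr>"

definition dual_module ::
  "('a, 'r) ring_scheme \<Rightarrow> ('a, 'm, 'x) module_scheme \<Rightarrow> ('a, 'm \<Rightarrow> 'a) module"
  where "dual_module R M = Hom_module R M (regular_module R)"

definition evaluation_map ::
  "('a, 'r) ring_scheme \<Rightarrow> ('a, 'm, 'x) module_scheme \<Rightarrow> 'm \<Rightarrow> ('m \<Rightarrow> 'a) \<Rightarrow> 'a"
  where "evaluation_map R M = (\<lambda>m\<in>carrier M. \<lambda>\<psi>\<in>carrier (dual_module R M). \<psi> m)"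

definition reflexive_module :: "('a, 'r) ring_scheme \<Rightarrow> ('a, 'm, 'x) module_scheme \<Rightarrow> bool"
  where "reflexive_module R M \<longleftrightarrow>
    evaluation_map R M \<in> mod_iso R M (dual_module R (dual_module R M))"

section \<open>Generation, freeness and direct summands\<close>

definition generated_submodule ::
  "('a, 'r) ring_scheme \<Rightarrow> ('a, 'm, 'x) module_scheme \<Rightarrow> 'm set \<Rightarrow> 'm set"
  where "generated_submodule R M S = \<Inter>{N. submodule N R M \<and> S \<subseteq> N}"

definition finitely_generated_module ::
  "('a, 'r) ring_scheme \<Rightarrow> ('a, 'm, 'x) module_scheme \<Rightarrow> bool"
  where "finitely_generated_module R M \<longleftrightarrow>
    (\<exists>S\<subseteq>carrier M. finite S \<and> generated_submodule R M S = carrier M)"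

definition linearly_independent ::
  "('a, 'r) ring_scheme \<Rightarrow> ('a, 'm, 'x) module_scheme \<Rightarrow> 'm set \<Rightarrow> bool"
  where "linearly_independent R M B \<longleftrightarrow>
    (\<forall>A\<subseteq>B. \<forall>c\<in>A \<rightarrow> carrier R. finite A \<longrightarrow>
       (\<Oplus>\<^bsub>M\<^esub>b\<in>A. c b \<odot>\<^bsub>M\<^esub> b) = \<zero>\<^bsub>M\<^esub> \<longrightarrow> (\<forall>b\<in>A. c b = \<zero>\<^bsub>R\<^esub>))"

definition module_basis ::
  "('a, 'r) ring_scheme \<Rightarrow> ('a, 'm, 'x) module_scheme \<Rightarrow> 'm set \<Rightarrow> bool"
  where "module_basis R M B \<longleftrightarrow>
    B \<subseteq> carrier M \<and> linearly_independent R M B \<and> generated_submodule R M B = carrier M"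

definition free_module :: "('a, 'r) ring_scheme \<Rightarrow> ('a, 'm, 'x) module_scheme \<Rightarrow> bool"
  where "free_module R M \<longleftrightarrow> (\<exists>B. module_basis R M B)"

definition has_free_summand :: "('a, 'r) ring_scheme \<Rightarrow> ('a, 'm, 'x) module_scheme \<Rightarrow> bool"
  where "has_free_summand R M \<longleftrightarrow>
    (\<exists>F N. submodule F R M \<and> submodule N R M \<and>
       F <+>\<^bsub>M\<^esub> N = carrier M \<and> F \<inter> N = {\<zero>\<^bsub>M\<^esub>} \<and>
       F \<noteq> {\<zero>\<^bsub>M\<^esub>} \<and> free_module R (M\<lparr>carrier := F\<rparr>))"

section \<open>Local rings and depth\<close>

locale local_ring = cring +
  assumes unique_maximalideal: "\<exists>!I. maximalideal I R"

definition max_ideal :: "('a, 'r) ring_scheme \<Rightarrow> 'a set"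
  where "max_ideal R = (THE I. maximalideal I R)"

text \<open>
  The first condition says that the class of \<open>xs ! i\<close> is a nonzerodivisor on
  \<open>R / (xs ! 0, \<dots>, xs ! (i - 1))\<close>, the second that \<open>R / (xs)\<close> is not zero.
\<close>

definition regular_sequence :: "('a, 'r) ring_scheme \<Rightarrow> 'a list \<Rightarrow> bool"
  where "regular_sequence R xs \<longleftrightarrow>
    set xs \<subseteq> carrier R \<and>
    (\<forall>i<length xs. \<forall>r\<in>carrier R.
       xs ! i \<otimes>\<^bsub>R\<^esub> r \<in> Idl\<^bsub>R\<^esub> (set (take i xs)) \<longrightarrow> r \<in> Idl\<^bsub>R\<^esub> (set (take i xs))) \<and>
    Idl\<^bsub>R\<^esub> (set xs) \<noteq> carrier R"

definition depth :: "('a, 'r) ring_scheme \<Rightarrow> enat"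
  where "depth R =
    Sup {enat (length xs) | xs. regular_sequence R xs \<and> set xs \<subseteq> max_ideal R}"

section \<open>The constructions are modules\<close>

lemma regular_module_module:
  assumes "cring R"
  shows "module R (regular_module R)"
proof -
  interpret cring R by fact
  show ?thesis
    by (rule moduleI)
      (auto simp: regular_module_def assms l_distr r_distr m_assoc
        intro!: abelian_groupI a_assoc a_comm intro: add.l_inv_ex)
qed

lemma Hom_module_module:
  assumes "module R M" "module R N"
  shows "module R (Hom_module R M N)"
proof -
  interpret M: module R M by fact
  interpret N: module R N by fact
  have closed: "f x \<in> carrier N" if "f \<in> mod_hom R M N" "x \<in> carrier M" for f x
    using that by (auto simp: mod_hom_def)
  have hom: "f (x \<oplus>\<^bsub>M\<^esub> y) = f x \<oplus>\<^bsub>N\<^esub> f y" "f (a \<odot>\<^bsub>M\<^esub> x) = a \<odot>\<^bsub>N\<^esub> f x"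
    if "f \<in> mod_hom R M N" "x \<in> carrier M" "y \<in> carrier M" "a \<in> carrier R" for f x y a
    using that by (auto simp: mod_hom_def)
  have add: "(\<lambda>x\<in>carrier M. f x \<oplus>\<^bsub>N\<^esub> g x) \<in> mod_hom R M N"
    if f: "f \<in> mod_hom R M N" and g: "g \<in> mod_hom R M N" for f g
    unfolding mod_hom_def
  proof (intro CollectI conjI ballI)
    fix x y assume "x \<in> carrier M" "y \<in> carrier M"
    then show "(\<lambda>x\<in>carrier M. f x \<oplus>\<^bsub>N\<^esub> g x) (x \<oplus>\<^bsub>M\<^esub> y) =
        (\<lambda>x\<in>carrier M. f x \<oplus>\<^bsub>N\<^esub> g x) x \<oplus>\<^bsub>N\<^esub> (\<lambda>x\<in>carrier M. f x \<oplus>\<^bsub>N\<^esub> g x) y"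
      by (simp add: hom(1)[OF f _ _ M.R.zero_closed] hom(1)[OF g _ _ M.R.zero_closed]
          closed[OF f] closed[OF g] N.M.add.m_ac)
  next
    fix a x assume "a \<in> carrier R" "x \<in> carrier M"
    then show "(\<lambda>x\<in>carrier M. f x \<oplus>\<^bsub>N\<^esub> g x) (a \<odot>\<^bsub>M\<^esub> x) =
        a \<odot>\<^bsub>N\<^esub> (\<lambda>x\<in>carrier M. f x \<oplus>\<^bsub>N\<^esub> g x) x"
      by (simp add: hom(2)[OF f _ M.M.zero_closed] hom(2)[OF g _ M.M.zero_closed]
          closed[OF f] closed[OF g] N.smult_r_distr)
  qed (simp add: closed[OF f] closed[OF g])
  have smult: "(\<lambda>x\<in>carrier M. a \<odot>\<^bsub>N\<^esub> f x) \<in> mod_hom R M N"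
    if a: "a \<in> carrier R" and f: "f \<in> mod_hom R M N" for a f
    unfolding mod_hom_def
  proof (intro CollectI conjI ballI)
    fix x y assume "x \<in> carrier M" "y \<in> carrier M"
    then show "(\<lambda>x\<in>carrier M. a \<odot>\<^bsub>N\<^esub> f x) (x \<oplus>\<^bsub>M\<^esub> y) =
        (\<lambda>x\<in>carrier M. a \<odot>\<^bsub>N\<^esub> f x) x \<oplus>\<^bsub>N\<^esub> (\<lambda>x\<in>carrier M. a \<odot>\<^bsub>N\<^esub> f x) y"
      by (simp add: hom(1)[OF f _ _ a] closed[OF f] a N.smult_r_distr)
  next
    fix b x assume b: "b \<in> carrier R" and x: "x \<in> carrier M"
    then show "(\<lambda>x\<in>carrier M. a \<odot>\<^bsub>N\<^esub> f x) (b \<odot>\<^bsub>M\<^esub> x) =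
        b \<odot>\<^bsub>N\<^esub> (\<lambda>x\<in>carrier M. a \<odot>\<^bsub>N\<^esub> f x) x"
      using a by (simp add: hom(2)[OF f _ M.M.zero_closed] closed[OF f] M.R.m_comm
          flip: N.smult_assoc1)
  qed (simp add: closed[OF f] a)
  have zero: "(\<lambda>x\<in>carrier M. \<zero>\<^bsub>N\<^esub>) \<in> mod_hom R M N"
    by (auto simp: mod_hom_def)
  have ext: "restrict f (carrier M) = f" if "f \<in> mod_hom R M N" for f
    using that by (auto simp: mod_hom_def PiE_iff extensional_restrict)
  have inv: "\<exists>g\<in>mod_hom R M N. (\<lambda>x\<in>carrier M. g x \<oplus>\<^bsub>N\<^esub> f x) = (\<lambda>x\<in>carrier M. \<zero>\<^bsub>N\<^esub>)"
    if f: "f \<in> mod_hom R M N" for f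
  proof (rule bexI)
    show "(\<lambda>x\<in>carrier M. (\<lambda>x\<in>carrier M. (\<ominus>\<^bsub>R\<^esub> \<one>\<^bsub>R\<^esub>) \<odot>\<^bsub>N\<^esub> f x) x \<oplus>\<^bsub>N\<^esub> f x)
      = (\<lambda>x\<in>carrier M. \<zero>\<^bsub>N\<^esub>)"
      using closed[OF f] by (intro restrict_ext) (simp add: N.smult_l_minus N.M.l_neg)
  qed (rule smult[OF _ f], simp)
  have "abelian_group (Hom_module R M N)"
    by (rule abelian_groupI)
      (use inv in \<open>auto simp: Hom_module_def add zero closed N.M.add.m_ac ext
        intro!: restrict_ext cong: restrict_cong\<close>)
  then show ?thesis
    by (intro moduleI M.R.is_cring)
      (auto simp: Hom_module_def smult closed N.smult_l_distr N.smult_r_distr N.smult_assoc1 ext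
        intro!: restrict_ext cong: restrict_cong)
qed

end

theory Submission
  imports Defs
begin

text \<open>
  Depth at most one provides \<open>x\<close> and \<open>y \<notin> xR\<close> with \<open>y \<mm> \<subseteq> xR\<close>, where \<open>x\<close> is zero or a nonzerodivisor:
  \<open>x = 0\<close> and a socle element \<open>y\<close> in depth zero, a regular element \<open>x\<close> and a lift of a socle element of
  \<open>R/x\<close> in depth one. Suppose that \<open>p\<close> is an endomorphism of \<open>M\<close> such that \<open>f(p m) \<in> \<mm>\<close> for all functionals
  \<open>f\<close> and all \<open>m\<close>. Then \<open>f \<mapsto> y f(p m) / x\<close> is a functional on \<open>M*\<close>, so reflexivity gives an endomorphism \<open>v\<close> with
  \<open>y p = x v\<close>.

  If \<open>M\<close> has no free summand, this applies to the identity and yields \<open>y h = x (v \<circ> h)\<close> for every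
  endomorphism \<open>h\<close>. Taking \<open>h\<close> to be a basis element of a free summand of \<open>End M\<close> and comparing
  coefficients gives \<open>y \<in> xR\<close>, a contradiction.

  If \<open>End M\<close> is free, split off free summands of rank one from \<open>M\<close> until the projection \<open>p\<close> onto the
  remaining summand satisfies the condition above. Then \<open>y p = x v\<close> forces the coefficients of \<open>p\<close> in a
  basis of \<open>End M\<close> to lie in \<open>\<mm>\<close>, hence \<open>p M = \<mm> p M\<close>, and \<open>p M = 0\<close> by Nakayama's lemma.
  Both splitting off and Nakayama's lemma reduce the number of generators of \<open>p M\<close>, so they are
  interleaved in a single induction on that number.
\<close>

section \<open>Ideals of zero divisors in Noetherian rings\<close>

text \<open>A nonempty chain of ideals in a Noetherian ring has its union as a member, so chains are
  bounded inside the family and Zorn's lemma applies.\<close>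

lemma (in noetherian_ring) exists_maximal_ideal_in:
  assumes "S \<noteq> {}" and "\<And>I. I \<in> S \<Longrightarrow> ideal I R"
  obtains I where "I \<in> S" and "\<And>J. J \<in> S \<Longrightarrow> I \<subseteq> J \<Longrightarrow> J = I"
proof -
  have "\<exists>I\<in>S. \<forall>J\<in>S. I \<subseteq> J \<longrightarrow> J = I"
  proof (rule subset_Zorn_nonempty[OF assms(1)])
    fix C assume C: "C \<noteq> {}" "subset.chain S C"
    then have "subset.chain {I. ideal I R} C"
      using assms(2) by (auto simp: subset.chain_def)
    then show "\<Union>C \<in> S"
      using ideal_chain_is_trivial[OF C(1)] C(2) by (auto simp: subset.chain_def)
  qed
  then show thesis
    using that by blast
qed

section \<open>Prime avoidance for pairwise incomparable primes\<close>

text \<open>Multiply one element of \<open>J\<close> and one of each \<open>Q\<close>, all chosen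
  outside \<open>P\<close>: the product lies in all these ideals, and primality keeps it outside
  \<open>P\<close>.\<close>

lemma (in cring) prime_avoids_intersection:
  assumes "finite \<P>" and P: "primeideal P R" and J: "ideal J R" "\<not> J \<subseteq> P"
    and "\<And>Q. Q \<in> \<P> \<Longrightarrow> ideal Q R \<and> \<not> Q \<subseteq> P"
  shows "\<exists>z\<in>J. (\<forall>Q\<in>\<P>. z \<in> Q) \<and> z \<notin> P"
  using assms(1,5)
proof (induction \<P>)
  case empty
  then show ?case using J by auto
next
  case (insert Q \<P>)
  then obtain z where z: "z \<in> J" "\<forall>Q\<in>\<P>. z \<in> Q" "z \<notin> P"
    by auto
  obtain q where q: "q \<in> Q" "q \<notin> P"
    using insert.prems[of Q] by auto
  have car: "z \<in> carrier R" "q \<in> carrier R"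
    using z q J insert.prems[of Q] by (auto dest: ideal.Icarr)
  have "z \<otimes> q \<notin> P"
    using primeideal.I_prime[OF P car] z q by auto
  moreover have "z \<otimes> q \<in> J"
    using ideal.I_r_closed[OF J(1) z(1) car(2)] .
  moreover have "z \<otimes> q \<in> Q'" if "Q' \<in> insert Q \<P>" for Q'
    using that ideal.I_r_closed[of Q' R z q] ideal.I_l_closed[of Q' R q z] z q car insert.prems
    by auto
  ultimately show ?case by blast
qed

text \<open>If an \<open>x\<close> avoiding the earlier primes falls into the new prime
  \<open>P\<close>, it is corrected by some \<open>z\<close> in \<open>J\<close> and in all earlier
  primes but not in \<open>P\<close>. Such a \<open>z\<close> exists by incomparability, and in each
  prime exactly one of \<open>x\<close> and \<open>z\<close> is missing, so \<open>x + z\<close>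
  avoids all of them.\<close>

lemma (in cring) prime_avoidance_antichain:
  assumes "finite \<P>" and J: "ideal J R"
    and "\<And>P. P \<in> \<P> \<Longrightarrow> primeideal P R \<and> \<not> J \<subseteq> P"
    and "\<And>P Q. P \<in> \<P> \<Longrightarrow> Q \<in> \<P> \<Longrightarrow> P \<subseteq> Q \<Longrightarrow> P = Q"
  shows "\<exists>x\<in>J. \<forall>P\<in>\<P>. x \<notin> P"
  using assms(1,3,4)
proof (induction \<P>)
  case empty
  then show ?case
    using additive_subgroup.zero_closed[OF ideal.axioms(1)[OF J]] by auto
next
  case (insert P \<P>)
  obtain x where x: "x \<in> J" "\<forall>P\<in>\<P>. x \<notin> P"
    using insert.IH insert.prems by (metis insertCI)
  show ?case
  proof (cases "x \<in> P")
    case False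
    then show ?thesis using x by auto
  next
    case True
    have "\<And>Q. Q \<in> \<P> \<Longrightarrow> ideal Q R \<and> \<not> Q \<subseteq> P"
      using insert.prems insert.hyps(2) by (metis insertCI primeideal.axioms(1))
    then obtain z where z: "z \<in> J" "\<forall>Q\<in>\<P>. z \<in> Q" "z \<notin> P"
      using prime_avoids_intersection[OF insert.hyps(1), of P J] insert.prems J by auto
    have car: "x \<in> carrier R" "z \<in> carrier R"
      using x z J by (auto dest: ideal.Icarr)
    have cancel_l: "b \<in> Q" if "ideal Q R" "a \<in> Q" "a \<oplus> b \<in> Q" "b \<in> carrier R" for Q a b
    proof -
      interpret ideal Q R by fact
      have "b = \<ominus> a \<oplus> (a \<oplus> b)"
        using that a_subset by (simp add: r_neg1 subset_iff)
      then show ?thesis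
        using that by (metis a_closed a_inv_closed)
    qed
    have "x \<oplus> z \<in> J"
      using x z J by (simp add: additive_subgroup.a_closed ideal.axioms(1))
    moreover have "x \<oplus> z \<notin> P"
      using cancel_l[of P x z] True z car insert.prems(1)[of P] primeideal.axioms(1) by auto
    moreover have "x \<oplus> z \<notin> Q" if "Q \<in> \<P>" for Q
      using cancel_l[of Q z x] that x z car insert.prems(1)[of Q] primeideal.axioms(1)
      by (auto simp: a_comm)
    ultimately show ?thesis by blast
  qed
qed

section \<open>Colon ideals \<open>(I : y)\<close>, the annihilators of residue classes in
  \<open>R/I\<close>\<close>

definition colon :: "('a, 'r) ring_scheme \<Rightarrow> 'a set \<Rightarrow> 'a \<Rightarrow> 'a set"
  where "colon R I y = {r \<in> carrier R. r \<otimes>\<^bsub>R\<^esub> y \<in> I}"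

lemma (in cring) colon_ideal:
  assumes "ideal I R" "y \<in> carrier R"
  shows "ideal (colon R I y) R"
proof -
  interpret ideal I R by fact
  have absorb: "a \<otimes> (x \<otimes> y) \<in> I" if "a \<in> carrier R" "x \<in> carrier R" "a \<otimes> y \<in> I" for a x
    using I_l_closed[OF that(3,2)] that assms(2) by (simp add: m_lcomm)
  show ?thesis
  proof (rule idealI)
    show "subgroup (colon R I y) (add_monoid R)"
      using assms(2)
      by (intro add.subgroupI)
        (auto simp: colon_def l_distr l_minus intro!: exI[of _ \<zero>] simp flip: a_inv_def)
  qed (use absorb in \<open>auto simp: colon_def assms m_assoc I_l_closed ring_axioms\<close>)
qed

text \<open>If \<open>b y\<close> is not in \<open>I\<close>, then \<open>(I : y)\<close> is
  contained in \<open>(I : b y)\<close>, and maximality makes them equal. From \<open>a b y\<close>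
  in \<open>I\<close> it follows that \<open>a\<close> lies in
  \<open>(I : b y) = (I : y)\<close>.\<close>

lemma (in cring) maximal_colon_prime:
  assumes I: "ideal I R" and y: "y \<in> carrier R" "y \<notin> I"
    and max: "\<And>z. z \<in> carrier R \<Longrightarrow> z \<notin> I \<Longrightarrow> colon R I y \<subseteq> colon R I z \<Longrightarrow> colon R I z = colon R I y"
  shows "primeideal (colon R I y) R"
proof (rule primeidealI)
  show "ideal (colon R I y) R"
    by (rule colon_ideal) fact+
  show "cring R" ..
  show "carrier R \<noteq> colon R I y"
  proof
    assume "carrier R = colon R I y"
    then have "\<one> \<in> colon R I y" by auto
    then show False using y by (simp add: colon_def)
  qed
  fix a b assume ab: "a \<in> carrier R" "b \<in> carrier R" "a \<otimes> b \<in> colon R I y"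
  show "a \<in> colon R I y \<or> b \<in> colon R I y"
  proof (cases "b \<otimes> y \<in> I")
    case False
    have "colon R I y \<subseteq> colon R I (b \<otimes> y)"
    proof
      fix r assume r: "r \<in> colon R I y"
      then have "r \<otimes> (b \<otimes> y) = b \<otimes> (r \<otimes> y)" "b \<otimes> (r \<otimes> y) \<in> I"
        using ab y ideal.I_l_closed[OF I] by (auto simp: colon_def intro: m_lcomm)
      then show "r \<in> colon R I (b \<otimes> y)"
        using r by (simp add: colon_def)
    qed
    then have "colon R I (b \<otimes> y) = colon R I y"
      using max[of "b \<otimes> y"] ab y False by auto
    moreover have "a \<in> colon R I (b \<otimes> y)"
      using ab y by (auto simp: colon_def m_assoc)
    ultimately show ?thesis by auto
  qed (use ab in \<open>auto simp: colon_def\<close>)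
qed

text \<open>The maximal colon ideals are finitely many primes: if \<open>A\<close> is a finite subset generating the
  same ideal as all \<open>y\<close> for which \<open>(I : y)\<close> is maximal, then each of them contains
  \<open>\<Inter>a\<in>A. (I : a)\<close>.\<close>

lemma zero_divisor_ideal_annihilated:
  fixes R (structure)
  assumes "cring R" and "noetherian_ring R" and I: "ideal I R" and J: "ideal J R"
    and zd: "\<And>w. w \<in> J \<Longrightarrow> \<exists>z\<in>carrier R. z \<notin> I \<and> w \<otimes> z \<in> I"
  obtains y where "y \<in> carrier R" "y \<notin> I" "\<And>w. w \<in> J \<Longrightarrow> w \<otimes> y \<in> I"
proof -
  interpret cring R by fact
  interpret noetherian_ring R by fact
  interpret I: ideal I R by fact
  interpret J: ideal J R by fact
  define C where "C = colon R I ` (carrier R - I)"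
  define Mx where "Mx = {P \<in> C. \<forall>Q\<in>C. P \<subseteq> Q \<longrightarrow> Q = P}"
  define T where "T = {y \<in> carrier R - I. colon R I y \<in> Mx}"
  have C_ideal: "ideal P R" if "P \<in> C" for P
    using that I by (auto simp: C_def intro: colon_ideal)
  have prime: "primeideal P R" if "P \<in> Mx" for P
    using that maximal_colon_prime[OF I] by (auto simp: Mx_def C_def)
  have ex_max: "\<exists>P\<in>Mx. Q \<subseteq> P" if Q: "Q \<in> C" for Q
  proof -
    obtain P where "P \<in> {P \<in> C. Q \<subseteq> P}" "\<And>P'. P' \<in> {P \<in> C. Q \<subseteq> P} \<Longrightarrow> P \<subseteq> P' \<Longrightarrow> P' = P"
      by (rule exists_maximal_ideal_in[of "{P \<in> C. Q \<subseteq> P}"]) (use Q C_ideal in auto)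
    then show ?thesis
      unfolding Mx_def by (intro bexI[of _ P]) auto
  qed
  \<comment> \<open>Among the ideals generated by finite subsets of \<open>T\<close>, a maximal one
    cannot grow when another element of \<open>T\<close> is added to the generators, so it contains
    \<open>T\<close>.\<close>
  obtain A where A: "finite A" "A \<subseteq> T" "T \<subseteq> Idl A"
  proof -
    let ?S = "{Idl A | A. finite A \<and> A \<subseteq> T}"
    have T: "T \<subseteq> carrier R" by (auto simp: T_def)
    obtain K where K: "K \<in> ?S" "\<And>K'. K' \<in> ?S \<Longrightarrow> K \<subseteq> K' \<Longrightarrow> K' = K"
      by (rule exists_maximal_ideal_in[of ?S]) (use T in \<open>auto intro!: genideal_ideal\<close>)
    then obtain A where A: "K = Idl A" "finite A" "A \<subseteq> T" by auto
    have "t \<in> Idl A" if "t \<in> T" for t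
    proof -
      have "Idl (insert t A) = Idl A"
        using K(2)[of "Idl (insert t A)"] A that T subset_Idl_subset[of "insert t A" A] by blast
      then show ?thesis
        using genideal_self[of "insert t A"] A that T by auto
    qed
    then show thesis
      using that A by auto
  qed
  have "\<exists>P\<in>colon R I ` A. J \<subseteq> P"
  proof (rule ccontr)
    assume no: "\<not> ?thesis"
    have A_Mx: "colon R I ` A \<subseteq> Mx"
      using A by (auto simp: T_def)
    have "\<exists>x\<in>J. \<forall>P\<in>colon R I ` A. x \<notin> P"
    proof (rule prime_avoidance_antichain)
      show "P = Q" if "P \<in> colon R I ` A" "Q \<in> colon R I ` A" "P \<subseteq> Q" for P Q
      proof -
        have "P \<in> Mx" "Q \<in> Mx" using that(1,2) A_Mx by blast+
        then show ?thesis using that(3) by (auto simp: Mx_def)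
      qed
      show "primeideal P R \<and> \<not> J \<subseteq> P" if "P \<in> colon R I ` A" for P
        using that no prime A_Mx by blast
    qed (use A J in simp_all)
    \<comment> \<open>Prime avoidance gives an \<open>x\<close> in \<open>J\<close> outside all
      \<open>(I : a)\<close> with \<open>a\<close> in \<open>A\<close>. As a zero divisor modulo
      \<open>I\<close>, it nevertheless lies in some maximal colon ideal \<open>P\<close>. The
      contradiction comes from showing that \<open>P\<close> is one of the
      \<open>(I : a)\<close>.\<close>
    then obtain x where x: "x \<in> J" "\<And>P. P \<in> colon R I ` A \<Longrightarrow> x \<notin> P" by auto
    obtain z where z: "z \<in> carrier R" "z \<notin> I" "x \<otimes> z \<in> I"
      using zd x by blast
    then obtain P where P: "P \<in> Mx" "colon R I z \<subseteq> P"
      using ex_max[of "colon R I z"] by (auto simp: C_def)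
    then obtain y where y: "y \<in> T" "P = colon R I y"
      by (auto simp: T_def Mx_def C_def)
    have "x \<in> P"
      using P z x by (auto simp: colon_def)
    \<comment> \<open>Otherwise some \<open>r\<close> outside \<open>P = (I : y)\<close> lies in
      every \<open>(I : a)\<close>. Then \<open>(I : r)\<close> contains \<open>A\<close>, hence
      \<open>Idl A\<close>, hence \<open>y\<close>; but \<open>r y\<close> in \<open>I\<close> puts
      \<open>r\<close> into \<open>P\<close>.\<close>
    have "\<exists>Q\<in>colon R I ` A. Q \<subseteq> P"
    proof (rule ccontr)
      assume no_Q: "\<not> ?thesis"
      have "\<exists>r\<in>carrier R. (\<forall>Q\<in>colon R I ` A. r \<in> Q) \<and> r \<notin> P"
      proof (rule prime_avoids_intersection)
        show "primeideal P R" by (rule prime) fact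
        then interpret P: primeideal P R .
        show "\<not> carrier R \<subseteq> P"
          using P.I_notcarr P.a_subset by auto
        show "ideal Q R \<and> \<not> Q \<subseteq> P" if "Q \<in> colon R I ` A" for Q
        proof
          show "ideal Q R"
            using that A_Mx by (intro primeideal.axioms(1) prime) auto
        qed (use that no_Q in auto)
        show "finite (colon R I ` A)" using A(1) by simp
      qed (rule oneideal)
      then obtain r where r: "r \<in> carrier R" "\<forall>a\<in>A. r \<otimes> a \<in> I" "r \<notin> P"
        by (auto simp: colon_def)
      have "Idl A \<subseteq> colon R I r"
        using r A by (intro genideal_minimal colon_ideal I) (auto simp: colon_def m_comm T_def subset_iff)
      then show False
        using r y A by (auto simp: colon_def m_comm T_def)
    qed
    then obtain Q where "Q \<in> colon R I ` A" "Q \<subseteq> P" by auto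
    then have "P \<in> colon R I ` A"
      using A_Mx P by (auto simp: Mx_def)
    then show False
      using x \<open>x \<in> P\<close> by auto
  qed
  then show thesis
    using that A by (auto simp: T_def colon_def)
qed

section \<open>Local rings of depth at most one\<close>

locale local_noetherian_ring = local_ring + noetherian_ring
begin

abbreviation \<mm> :: "'a set" where "\<mm> \<equiv> max_ideal R"

lemma max_ideal_maximal: "maximalideal \<mm> R"
  unfolding max_ideal_def using unique_maximalideal by (rule theI')

sublocale max: maximalideal \<mm> R
  by (rule max_ideal_maximal)

lemma one_notin_max_ideal: "\<one> \<notin> \<mm>"
  using max.I_notcarr max.one_imp_carrier by auto

text \<open>Were \<open>PIdl x\<close> proper, the maximum condition would give an ideal maximal
  among the proper ideals containing it, and by uniqueness this would be
  \<open>\<mm>\<close>.\<close>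

lemma unit_if_notin_max_ideal:
  assumes x: "x \<in> carrier R" "x \<notin> \<mm>"
  obtains u where "u \<in> carrier R" "u \<otimes> x = \<one>"
proof -
  have "PIdl x = carrier R"
  proof (rule ccontr)
    assume ne: "PIdl x \<noteq> carrier R"
    let ?S = "{J. ideal J R \<and> PIdl x \<subseteq> J \<and> J \<noteq> carrier R}"
    obtain K where K: "K \<in> ?S" "\<And>J. J \<in> ?S \<Longrightarrow> K \<subseteq> J \<Longrightarrow> J = K"
      by (rule exists_maximal_ideal_in[of ?S]) (use ne x cgenideal_ideal in auto)
    have "maximalideal K R"
    proof (rule maximalidealI)
      fix J assume "ideal J R" "K \<subseteq> J"
      then show "J = K \<or> J = carrier R"
        using K(1) K(2)[of J] by auto
    qed (use K in auto)
    then have "K = \<mm>"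
      using max_ideal_maximal unique_maximalideal by blast
    then show False
      using K cgenideal_self[OF x(1)] x by auto
  qed
  then have "\<one> \<in> PIdl x" by simp
  then show thesis
    using that by (auto simp: cgenideal_def)
qed

text \<open>Take a nonzerodivisor \<open>x\<close> in \<open>\<mm>\<close> if there is one, and
  \<open>x = 0\<close> otherwise. In both cases every element of \<open>\<mm>\<close> is a zero
  divisor modulo \<open>x R\<close>, so one \<open>y\<close> outside \<open>x R\<close> is
  multiplied into \<open>x R\<close> by all of \<open>\<mm>\<close>. Keeping \<open>x = 0\<close> as
  an admissible value lets both depths be treated together later.\<close>

lemma regular_or_zero_socle:
  assumes "depth R \<le> 1"
  obtains x y where "x \<in> carrier R" "y \<in> carrier R"
    and "x = \<zero> \<or> (\<forall>r\<in>carrier R. x \<otimes> r = \<zero> \<longrightarrow> r = \<zero>)"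
    and "\<And>r. r \<in> carrier R \<Longrightarrow> y \<noteq> x \<otimes> r"
    and "\<And>w. w \<in> \<mm> \<Longrightarrow> \<exists>r\<in>carrier R. y \<otimes> w = x \<otimes> r"
proof -
  obtain x where x: "x \<in> \<mm>" "x = \<zero> \<or> (\<forall>r\<in>carrier R. x \<otimes> r = \<zero> \<longrightarrow> r = \<zero>)"
    and zd: "\<And>w. w \<in> \<mm> \<Longrightarrow> \<exists>z\<in>carrier R. z \<notin> PIdl x \<and> w \<otimes> z \<in> PIdl x"
  proof (cases "\<exists>x\<in>\<mm>. \<forall>r\<in>carrier R. x \<otimes> r = \<zero> \<longrightarrow> r = \<zero>")
    case False
    have "PIdl \<zero> = {\<zero>}"
      using cgenideal_eq_genideal[of \<zero>] genideal_zero by simp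
    then show thesis
      using False by (intro that[of \<zero>]) auto
  next
    case True
    then obtain x where x: "x \<in> \<mm>" "\<forall>r\<in>carrier R. x \<otimes> r = \<zero> \<longrightarrow> r = \<zero>" by auto
    have "\<exists>z\<in>carrier R. z \<notin> PIdl x \<and> w \<otimes> z \<in> PIdl x" if w: "w \<in> \<mm>" for w
    proof (rule ccontr)
      assume no: "\<not> ?thesis"
      have PIdl: "PIdl x = Idl {x}"
        using cgenideal_eq_genideal x by auto
      have Idl_empty: "Idl {} = {\<zero>}"
        using genideal_minimal[OF zeroideal, of "{}"] additive_subgroup.zero_closed[OF ideal.axioms(1)[OF genideal_ideal[of "{}"]]]
        by auto
      have "Idl {x, w} \<subseteq> \<mm>"
        using x w by (intro genideal_minimal max.is_ideal) auto
      then have "Idl {x, w} \<noteq> carrier R"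
        using one_notin_max_ideal by auto
      \<comment> \<open>The negated claim says precisely that \<open>w\<close> is a nonzerodivisor
        modulo \<open>x R\<close>; the resulting regular sequence of length two exceeds the
        depth.\<close>
      then have "regular_sequence R [x, w]"
        using x w no by (auto simp: regular_sequence_def less_Suc_eq Idl_empty PIdl)
      then have "enat (length [x, w]) \<le> depth R"
        unfolding depth_def using x w by (intro Sup_upper) force
      then have "enat 2 \<le> 1"
        using assms by (metis (no_types, lifting) length_Cons list.size(3) numeral_2_eq_2 order_trans)
      then show False by (simp add: one_enat_def)
    qed
    then show thesis
      using x by (intro that[of x]) auto
  qed
  have car: "x \<in> carrier R" using x by auto
  obtain y where y: "y \<in> carrier R" "y \<notin> PIdl x" "\<And>w. w \<in> \<mm> \<Longrightarrow> w \<otimes> y \<in> PIdl x"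
    by (rule zero_divisor_ideal_annihilated[OF is_cring noetherian_ring_axioms cgenideal_ideal[OF car]
        max.is_ideal]) (use zd in blast)+
  show thesis
  proof (rule that[of x y])
    show "y \<noteq> x \<otimes> r" if "r \<in> carrier R" for r
      using y(2) that car by (auto simp: cgenideal_def m_comm)
    show "\<exists>r\<in>carrier R. y \<otimes> w = x \<otimes> r" if "w \<in> \<mm>" for w
      using y(1) y(3)[OF that] car max.Icarr[OF that] by (auto simp: cgenideal_def m_comm)
  qed (use x y car in auto)
qed

end

section \<open>Spans and bases\<close>

context module
begin

lemma generated_submodule_superset: "S \<subseteq> generated_submodule R M S"
  by (auto simp: generated_submodule_def)

lemma generated_submodule_minimal:
  "submodule N R M \<Longrightarrow> S \<subseteq> N \<Longrightarrow> generated_submodule R M S \<subseteq> N"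
  by (auto simp: generated_submodule_def)

lemma generated_submodule_submodule:
  assumes "S \<subseteq> carrier M"
  shows "submodule (generated_submodule R M S) R M"
proof (rule submoduleI)
  show "generated_submodule R M S \<subseteq> carrier M"
    using assms by (rule generated_submodule_minimal[OF carrier_is_submodule])
  show "\<zero>\<^bsub>M\<^esub> \<in> generated_submodule R M S"
    by (auto simp: generated_submodule_def submodule_def dest: subgroup.one_closed)
  show "\<ominus>\<^bsub>M\<^esub> a \<in> generated_submodule R M S" if "a \<in> generated_submodule R M S" for a
    using that by (auto simp: generated_submodule_def submoduleE(3))
  show "a \<oplus>\<^bsub>M\<^esub> b \<in> generated_submodule R M S"
    if "a \<in> generated_submodule R M S" "b \<in> generated_submodule R M S" for a b
    using that by (auto simp: generated_submodule_def submoduleE(5))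
  show "a \<odot>\<^bsub>M\<^esub> b \<in> generated_submodule R M S"
    if "a \<in> carrier R" "b \<in> generated_submodule R M S" for a b
    using that by (auto simp: generated_submodule_def submoduleE(4))
qed

lemma submodule_zero: "submodule N R M \<Longrightarrow> \<zero>\<^bsub>M\<^esub> \<in> N"
  by (auto simp: submodule_def dest: subgroup.one_closed)

lemma submodule_finsum:
  assumes N: "submodule N R M" and "finite A" and "f \<in> A \<rightarrow> N"
  shows "finsum M f A \<in> N"
  using assms(2,3)
proof (induction A)
  case empty
  then show ?case using submodule_zero[OF N] by simp
next
  case (insert a A)
  then have "f \<in> A \<rightarrow> carrier M" "f a \<in> carrier M"
    using submoduleE(1)[OF N] by auto
  then show ?case
    using insert submoduleE(5)[OF N] by (simp add: Pi_iff)
qed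

section \<open>Linear combinations with finite support and coordinates in a basis\<close>

text \<open>Padding with zero coefficients brings combinations with different supports onto their
  union, where they can be added and compared.\<close>

lemma lincomb_extend:
  assumes "finite A'" "A \<subseteq> A'" "A' \<subseteq> carrier M" "c \<in> A \<rightarrow> carrier R"
  shows "(\<Oplus>\<^bsub>M\<^esub>b\<in>A. c b \<odot>\<^bsub>M\<^esub> b) = (\<Oplus>\<^bsub>M\<^esub>b\<in>A'. (if b \<in> A then c b else \<zero>) \<odot>\<^bsub>M\<^esub> b)"
  using assms by (intro M.add.finprod_mono_neutral_cong_left) (auto simp: subset_iff Pi_iff)

lemma lincomb_add:
  assumes "A \<subseteq> carrier M" "c \<in> A \<rightarrow> carrier R" "d \<in> A \<rightarrow> carrier R"
  shows "(\<Oplus>\<^bsub>M\<^esub>b\<in>A. (c b \<oplus> d b) \<odot>\<^bsub>M\<^esub> b) =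
    (\<Oplus>\<^bsub>M\<^esub>b\<in>A. c b \<odot>\<^bsub>M\<^esub> b) \<oplus>\<^bsub>M\<^esub> (\<Oplus>\<^bsub>M\<^esub>b\<in>A. d b \<odot>\<^bsub>M\<^esub> b)"
proof -
  have "(\<Oplus>\<^bsub>M\<^esub>b\<in>A. (c b \<oplus> d b) \<odot>\<^bsub>M\<^esub> b) = (\<Oplus>\<^bsub>M\<^esub>b\<in>A. c b \<odot>\<^bsub>M\<^esub> b \<oplus>\<^bsub>M\<^esub> d b \<odot>\<^bsub>M\<^esub> b)"
    using assms by (intro M.finsum_cong') (auto simp: smult_l_distr Pi_iff subset_iff)
  then show ?thesis
    using assms by (subst (asm) M.finsum_addf) (auto simp: Pi_iff subset_iff)
qed

lemma lincomb_smult: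
  assumes "finite A" "A \<subseteq> carrier M" "c \<in> A \<rightarrow> carrier R" "a \<in> carrier R"
  shows "a \<odot>\<^bsub>M\<^esub> (\<Oplus>\<^bsub>M\<^esub>b\<in>A. c b \<odot>\<^bsub>M\<^esub> b) = (\<Oplus>\<^bsub>M\<^esub>b\<in>A. (a \<otimes> c b) \<odot>\<^bsub>M\<^esub> b)"
proof -
  have "a \<odot>\<^bsub>M\<^esub> (\<Oplus>\<^bsub>M\<^esub>b\<in>A. c b \<odot>\<^bsub>M\<^esub> b) = (\<Oplus>\<^bsub>M\<^esub>b\<in>A. a \<odot>\<^bsub>M\<^esub> (c b \<odot>\<^bsub>M\<^esub> b))"
    using assms by (intro finsum_smult_ldistr) (auto simp: Pi_iff subset_iff)
  also have "\<dots> = (\<Oplus>\<^bsub>M\<^esub>b\<in>A. (a \<otimes> c b) \<odot>\<^bsub>M\<^esub> b)"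
    using assms by (intro M.finsum_cong') (auto simp: smult_assoc1 Pi_iff subset_iff)
  finally show ?thesis .
qed

text \<open>Spans are defined as intersections of submodules. The finite linear combinations form a
  submodule containing \<open>B\<close>, so they contain the span.\<close>

lemma generated_submodule_lincomb:
  assumes B: "B \<subseteq> carrier M" and v: "v \<in> generated_submodule R M B"
  obtains A c where "finite A" "A \<subseteq> B" "c \<in> A \<rightarrow> carrier R" "v = (\<Oplus>\<^bsub>M\<^esub>b\<in>A. c b \<odot>\<^bsub>M\<^esub> b)"
proof -
  let ?L = "{(\<Oplus>\<^bsub>M\<^esub>b\<in>A. c b \<odot>\<^bsub>M\<^esub> b) | A c. finite A \<and> A \<subseteq> B \<and> c \<in> A \<rightarrow> carrier R}"
  have smult: "a \<odot>\<^bsub>M\<^esub> l \<in> ?L" if a: "a \<in> carrier R" and l: "l \<in> ?L" for a l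
  proof -
    from l obtain A c where A: "finite A" "A \<subseteq> B" "c \<in> A \<rightarrow> carrier R"
        "l = (\<Oplus>\<^bsub>M\<^esub>b\<in>A. c b \<odot>\<^bsub>M\<^esub> b)" by auto
    then have "a \<odot>\<^bsub>M\<^esub> l = (\<Oplus>\<^bsub>M\<^esub>b\<in>A. (a \<otimes> c b) \<odot>\<^bsub>M\<^esub> b)"
      using lincomb_smult[of A c a] B a by auto
    moreover have "(\<lambda>b. a \<otimes> c b) \<in> A \<rightarrow> carrier R"
      using A a by auto
    ultimately show ?thesis
      using A(1,2) by (intro CollectI exI[of _ A] exI[of _ "\<lambda>b. a \<otimes> c b"]) simp
  qed
  have sub: "?L \<subseteq> carrier M"
    using B by (auto intro!: M.finsum_closed simp: Pi_iff subset_iff)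
  have "submodule ?L R M"
  proof (rule submoduleI)
    show "\<zero>\<^bsub>M\<^esub> \<in> ?L"
      by (auto intro!: exI[of _ "{}"])
    show "\<ominus>\<^bsub>M\<^esub> l \<in> ?L" if "l \<in> ?L" for l
      using smult[of "\<ominus> \<one>" l] that sub smult_l_minus[of \<one> l] by (auto simp: subset_iff)
    fix k l assume "k \<in> ?L" "l \<in> ?L"
    then obtain A c A' d where *: "finite A" "A \<subseteq> B" "c \<in> A \<rightarrow> carrier R"
        "finite A'" "A' \<subseteq> B" "d \<in> A' \<rightarrow> carrier R"
        "k = (\<Oplus>\<^bsub>M\<^esub>b\<in>A. c b \<odot>\<^bsub>M\<^esub> b)" "l = (\<Oplus>\<^bsub>M\<^esub>b\<in>A'. d b \<odot>\<^bsub>M\<^esub> b)"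
      by auto
    let ?c = "\<lambda>b. if b \<in> A then c b else \<zero>" and ?d = "\<lambda>b. if b \<in> A' then d b else \<zero>"
    have cd: "?c \<in> A \<union> A' \<rightarrow> carrier R" "?d \<in> A \<union> A' \<rightarrow> carrier R"
      using * by (auto simp: Pi_iff)
    have AM: "A \<union> A' \<subseteq> carrier M"
      using * B by auto
    have "k = (\<Oplus>\<^bsub>M\<^esub>b\<in>A \<union> A'. ?c b \<odot>\<^bsub>M\<^esub> b)" "l = (\<Oplus>\<^bsub>M\<^esub>b\<in>A \<union> A'. ?d b \<odot>\<^bsub>M\<^esub> b)"
      using * B by (auto intro!: lincomb_extend)
    then have "k \<oplus>\<^bsub>M\<^esub> l = (\<Oplus>\<^bsub>M\<^esub>b\<in>A \<union> A'. (?c b \<oplus> ?d b) \<odot>\<^bsub>M\<^esub> b)"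
      by (simp only: lincomb_add[OF AM cd])
    moreover have "(\<lambda>b. ?c b \<oplus> ?d b) \<in> A \<union> A' \<rightarrow> carrier R"
      using cd by (auto simp: Pi_iff)
    ultimately show "k \<oplus>\<^bsub>M\<^esub> l \<in> ?L"
      using *(1,2,4,5) by (intro CollectI exI[of _ "A \<union> A'"] exI[of _ "\<lambda>b. ?c b \<oplus> ?d b"]) simp
  qed (use smult sub in blast)+
  moreover have "B \<subseteq> ?L"
  proof
    fix b assume "b \<in> B"
    then have "b = (\<Oplus>\<^bsub>M\<^esub>b\<in>{b}. \<one> \<odot>\<^bsub>M\<^esub> b)"
      using B by (subst M.finsum_insert) (auto simp: subset_iff)
    then show "b \<in> ?L"
      using \<open>b \<in> B\<close> by (intro CollectI exI[of _ "{b}"] exI[of _ "\<lambda>_. \<one>"]) auto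
  qed
  ultimately have "v \<in> ?L"
    using generated_submodule_minimal v by blast
  then show thesis
    using that by auto
qed

text \<open>Coordinates in a basis are unique, so \<open>y\<close> times the coordinate at
  \<open>b\<close> on the left equals \<open>x\<close> times that of \<open>w\<close>, which is zero
  if \<open>b\<close> is outside the support of \<open>w\<close>. This turns divisibility in a free
  module into divisibility in \<open>R\<close>.\<close>

lemma lincomb_divisible:
  assumes B: "module_basis R M B" and A: "finite A" "A \<subseteq> B" "c \<in> A \<rightarrow> carrier R"
    and xy: "x \<in> carrier R" "y \<in> carrier R" and w: "w \<in> carrier M"
    and eq: "y \<odot>\<^bsub>M\<^esub> (\<Oplus>\<^bsub>M\<^esub>b\<in>A. c b \<odot>\<^bsub>M\<^esub> b) = x \<odot>\<^bsub>M\<^esub> w"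
    and b: "b \<in> A"
  shows "\<exists>d\<in>carrier R. y \<otimes> c b = x \<otimes> d"
proof -
  have BM: "B \<subseteq> carrier M" and li: "linearly_independent R M B"
    and gen: "w \<in> generated_submodule R M B"
    using B w by (auto simp: module_basis_def)
  obtain A' d where A': "finite A'" "A' \<subseteq> B" "d \<in> A' \<rightarrow> carrier R"
      "w = (\<Oplus>\<^bsub>M\<^esub>b\<in>A'. d b \<odot>\<^bsub>M\<^esub> b)"
    by (rule generated_submodule_lincomb[OF BM gen])
  let ?E = "A \<union> A'"
  let ?c = "\<lambda>b. if b \<in> A then c b else \<zero>" and ?d = "\<lambda>b. if b \<in> A' then d b else \<zero>"
  have E: "finite ?E" "?E \<subseteq> carrier M" "?E \<subseteq> B"
    using A A' BM by auto
  have cd: "?c \<in> ?E \<rightarrow> carrier R" "?d \<in> ?E \<rightarrow> carrier R"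
    using A A' by (auto simp: Pi_iff)
  have ycxd: "(\<lambda>b. y \<otimes> ?c b) \<in> ?E \<rightarrow> carrier R" "(\<lambda>b. \<ominus> x \<otimes> ?d b) \<in> ?E \<rightarrow> carrier R"
    using cd xy by (auto simp: Pi_iff)
  have "(\<Oplus>\<^bsub>M\<^esub>b\<in>A. c b \<odot>\<^bsub>M\<^esub> b) = (\<Oplus>\<^bsub>M\<^esub>b\<in>?E. ?c b \<odot>\<^bsub>M\<^esub> b)"
    using A A' E by (intro lincomb_extend) auto
  moreover have "w = (\<Oplus>\<^bsub>M\<^esub>b\<in>?E. ?d b \<odot>\<^bsub>M\<^esub> b)"
    unfolding A'(4) using A A' E by (intro lincomb_extend) auto
  ultimately have "(\<Oplus>\<^bsub>M\<^esub>b\<in>?E. (y \<otimes> ?c b \<oplus> \<ominus> x \<otimes> ?d b) \<odot>\<^bsub>M\<^esub> b) =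
      y \<odot>\<^bsub>M\<^esub> (\<Oplus>\<^bsub>M\<^esub>b\<in>A. c b \<odot>\<^bsub>M\<^esub> b) \<oplus>\<^bsub>M\<^esub> (\<ominus> x) \<odot>\<^bsub>M\<^esub> w"
    using lincomb_add[OF E(2) ycxd] lincomb_smult[OF E(1,2) cd(1) xy(2)]
      lincomb_smult[OF E(1,2) cd(2), of "\<ominus> x"] xy by simp
  also have "\<dots> = \<zero>\<^bsub>M\<^esub>"
    using eq xy w by (simp add: smult_l_minus M.r_neg)
  finally have sum0: "(\<Oplus>\<^bsub>M\<^esub>b\<in>?E. (y \<otimes> ?c b \<oplus> \<ominus> x \<otimes> ?d b) \<odot>\<^bsub>M\<^esub> b) = \<zero>\<^bsub>M\<^esub>" .
  have "(\<lambda>b. y \<otimes> ?c b \<oplus> \<ominus> x \<otimes> ?d b) \<in> ?E \<rightarrow> carrier R"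
    using ycxd by (auto simp only: Pi_iff intro!: R.add.m_closed)
  from li[unfolded linearly_independent_def, rule_format, OF E(3) this E(1) sum0]
  have "y \<otimes> ?c b \<oplus> \<ominus> x \<otimes> ?d b = \<zero>" if "b \<in> ?E" for b
    using that .
  then have "y \<otimes> c b \<oplus> \<ominus> x \<otimes> ?d b = \<zero>"
    using b by force
  moreover have "c b \<in> carrier R" "?d b \<in> carrier R"
    using b A(3) funcset_mem[OF cd(2), of b] by auto
  ultimately have "y \<otimes> c b = x \<otimes> ?d b"
    using xy by (simp add: l_minus R.minus_eq[symmetric] R.r_right_minus_eq)
  then show ?thesis
    using \<open>?d b \<in> carrier R\<close> by blast
qed

end

section \<open>Linear maps\<close>

text \<open>A name for the underlying set of \<open>M*\<close>, so that functionals can be handled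
  with the operations of \<open>R\<close> rather than those of the record
  \<open>regular_module R\<close>.\<close>

definition dual_space :: "('a, 'r) ring_scheme \<Rightarrow> ('a, 'm, 'x) module_scheme \<Rightarrow> ('m \<Rightarrow> 'a) set"
  where "dual_space R M = carrier (dual_module R M)"

lemma mod_homD:
  assumes "f \<in> mod_hom R M N"
  shows "x \<in> carrier M \<Longrightarrow> f x \<in> carrier N"
    and "x \<in> carrier M \<Longrightarrow> y \<in> carrier M \<Longrightarrow> f (x \<oplus>\<^bsub>M\<^esub> y) = f x \<oplus>\<^bsub>N\<^esub> f y"
    and "a \<in> carrier R \<Longrightarrow> x \<in> carrier M \<Longrightarrow> f (a \<odot>\<^bsub>M\<^esub> x) = a \<odot>\<^bsub>N\<^esub> f x"
  using assms by (auto simp: mod_hom_def)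

lemma mod_hom_restrictI:
  assumes "\<And>x. x \<in> carrier M \<Longrightarrow> f x \<in> carrier N"
    and "\<And>x y. x \<in> carrier M \<Longrightarrow> y \<in> carrier M \<Longrightarrow> f (x \<oplus>\<^bsub>M\<^esub> y) = f x \<oplus>\<^bsub>N\<^esub> f y"
    and "\<And>a x. a \<in> carrier R \<Longrightarrow> x \<in> carrier M \<Longrightarrow> f (a \<odot>\<^bsub>M\<^esub> x) = a \<odot>\<^bsub>N\<^esub> f x"
    and "module R M"
  shows "restrict f (carrier M) \<in> mod_hom R M N"
proof -
  interpret module R M by fact
  show ?thesis
    using assms(1-3) by (auto simp: mod_hom_def)
qed

lemma dual_spaceD:
  assumes "f \<in> dual_space R M"
  shows "x \<in> carrier M \<Longrightarrow> f x \<in> carrier R"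
    and "x \<in> carrier M \<Longrightarrow> y \<in> carrier M \<Longrightarrow> f (x \<oplus>\<^bsub>M\<^esub> y) = f x \<oplus>\<^bsub>R\<^esub> f y"
    and "a \<in> carrier R \<Longrightarrow> x \<in> carrier M \<Longrightarrow> f (a \<odot>\<^bsub>M\<^esub> x) = a \<otimes>\<^bsub>R\<^esub> f x"
  using assms by (auto simp: dual_space_def dual_module_def Hom_module_def regular_module_def mod_hom_def)

lemma dual_space_restrictI:
  assumes "\<And>x. x \<in> carrier M \<Longrightarrow> f x \<in> carrier R"
    and "\<And>x y. x \<in> carrier M \<Longrightarrow> y \<in> carrier M \<Longrightarrow> f (x \<oplus>\<^bsub>M\<^esub> y) = f x \<oplus>\<^bsub>R\<^esub> f y"
    and "\<And>a x. a \<in> carrier R \<Longrightarrow> x \<in> carrier M \<Longrightarrow> f (a \<odot>\<^bsub>M\<^esub> x) = a \<otimes>\<^bsub>R\<^esub> f x"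
    and "module R M"
  shows "restrict f (carrier M) \<in> dual_space R M"
  using mod_hom_restrictI[of M f "regular_module R" R] assms
  by (auto simp: dual_space_def dual_module_def Hom_module_def regular_module_def)

context module
begin

lemma mod_hom_zero:
  assumes "f \<in> mod_hom R M N" "module R N"
  shows "f \<zero>\<^bsub>M\<^esub> = \<zero>\<^bsub>N\<^esub>"
proof -
  interpret N: module R N by fact
  show ?thesis
    using mod_homD(1)[OF assms(1), of "\<zero>\<^bsub>M\<^esub>"] mod_homD(3)[OF assms(1), of \<zero> "\<zero>\<^bsub>M\<^esub>"] by simp
qed

lemma dual_space_zero:
  assumes "f \<in> dual_space R M"
  shows "f \<zero>\<^bsub>M\<^esub> = \<zero>"
  using dual_spaceD(1)[OF assms, of "\<zero>\<^bsub>M\<^esub>"] dual_spaceD(3)[OF assms, of \<zero> "\<zero>\<^bsub>M\<^esub>"] by simp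

lemma dual_space_smult:
  assumes "f \<in> dual_space R M" "u \<in> carrier R"
  shows "(\<lambda>x\<in>carrier M. u \<otimes> f x) \<in> dual_space R M"
  by (rule dual_space_restrictI)
    (use dual_spaceD[OF assms(1)] assms(2) module_axioms in \<open>auto simp: r_distr m_lcomm\<close>)

end

section \<open>Reflexive modules\<close>

lemma (in module) dual_module_module: "module R (dual_module R M)"
  unfolding dual_module_def
  by (intro Hom_module_module module_axioms regular_module_module R.is_cring)

text \<open>The injective half of reflexivity.\<close>

lemma (in module) reflexive_separates:
  assumes "reflexive_module R M" and mn: "m \<in> carrier M" "n \<in> carrier M"
    and eq: "\<And>f. f \<in> dual_space R M \<Longrightarrow> f m = f n"
  shows "m = n"
proof -
  have "inj_on (evaluation_map R M) (carrier M)"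
    using assms(1) by (auto simp: reflexive_module_def mod_iso_def bij_betw_def)
  moreover have "evaluation_map R M m = evaluation_map R M n"
    using mn eq by (auto simp: evaluation_map_def dual_space_def intro!: restrict_ext)
  ultimately show ?thesis
    using mn by (auto dest: inj_onD)
qed

text \<open>The surjective half of reflexivity: the conditions on \<open>\<Phi>\<close> make its
  restriction an element of the double dual.\<close>

lemma (in module) reflexive_represents:
  assumes "reflexive_module R M"
    and "\<And>f. f \<in> dual_space R M \<Longrightarrow> \<Phi> f \<in> carrier R"
    and "\<And>f g. f \<in> dual_space R M \<Longrightarrow> g \<in> dual_space R M \<Longrightarrow>
      \<Phi> (\<lambda>x\<in>carrier M. f x \<oplus> g x) = \<Phi> f \<oplus> \<Phi> g"
    and "\<And>a f. a \<in> carrier R \<Longrightarrow> f \<in> dual_space R M \<Longrightarrow>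
      \<Phi> (\<lambda>x\<in>carrier M. a \<otimes> f x) = a \<otimes> \<Phi> f"
  obtains n where "n \<in> carrier M" "\<And>f. f \<in> dual_space R M \<Longrightarrow> \<Phi> f = f n"
proof -
  have "restrict \<Phi> (carrier (dual_module R M)) \<in> dual_space R (dual_module R M)"
  proof (rule dual_space_restrictI[OF _ _ _ dual_module_module])
  qed (use assms(2-4) in \<open>auto simp: dual_space_def dual_module_def Hom_module_def regular_module_def\<close>)
  also have "dual_space R (dual_module R M) = evaluation_map R M ` carrier M"
    using assms(1) by (auto simp: reflexive_module_def mod_iso_def bij_betw_def dual_space_def)
  finally obtain n where n: "n \<in> carrier M"
      "evaluation_map R M n = restrict \<Phi> (carrier (dual_module R M))"
    by (metis imageE)
  have "\<Phi> f = f n" if "f \<in> dual_space R M" for f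
    using fun_cong[OF n(2), of f] n(1) that by (simp add: evaluation_map_def dual_space_def)
  then show thesis
    using n that by blast
qed

text \<open>If \<open>x\<close> is a nonzerodivisor, then \<open>f \<mapsto> y f(p m) / x\<close> is an element of \<open>M**\<close>, hence is
  evaluation at some \<open>v m\<close>.\<close>

lemma (in module) reflexive_divide_endomorphism:
  assumes refl: "reflexive_module R M" and p: "p \<in> mod_hom R M M"
    and xy: "x \<in> carrier R" "y \<in> carrier R"
    and x: "x = \<zero> \<or> (\<forall>r\<in>carrier R. x \<otimes> r = \<zero> \<longrightarrow> r = \<zero>)"
    and div: "\<And>f m. f \<in> dual_space R M \<Longrightarrow> m \<in> carrier M \<Longrightarrow> \<exists>r\<in>carrier R. y \<otimes> f (p m) = x \<otimes> r"
  obtains v where "v \<in> mod_hom R M M"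
    and "\<And>m. m \<in> carrier M \<Longrightarrow> y \<odot>\<^bsub>M\<^esub> p m = x \<odot>\<^bsub>M\<^esub> v m"
proof -
  have pM: "p m \<in> carrier M" if "m \<in> carrier M" for m
    using mod_homD(1)[OF p that] .
  have *: "y \<odot>\<^bsub>M\<^esub> p m = x \<odot>\<^bsub>M\<^esub> n"
    if "m \<in> carrier M" "n \<in> carrier M" "\<And>f. f \<in> dual_space R M \<Longrightarrow> y \<otimes> f (p m) = x \<otimes> f n" for m n
    by (rule reflexive_separates[OF refl]) (use that xy pM in \<open>auto simp: dual_spaceD(3)\<close>)
  show thesis
  proof (cases "x = \<zero>")
    case True
    \<comment> \<open>For \<open>x = 0\<close>, the assumption \<open>div\<close> says that every
      functional vanishes at \<open>y (p m)\<close>. Hence \<open>y (p m) = 0\<close>, and the zero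
      map serves as \<open>v\<close>.\<close>
    have "(\<lambda>m\<in>carrier M. \<zero>\<^bsub>M\<^esub>) \<in> mod_hom R M M"
      by (rule mod_hom_restrictI) (auto simp: module_axioms)
    moreover have "y \<odot>\<^bsub>M\<^esub> p m = x \<odot>\<^bsub>M\<^esub> \<zero>\<^bsub>M\<^esub>" if "m \<in> carrier M" for m
      using div[OF _ that] True by (intro * that) (auto simp: dual_space_zero)
    ultimately show ?thesis
      by (intro that[of "\<lambda>m\<in>carrier M. \<zero>\<^bsub>M\<^esub>"]) auto
  next
    case False
    have cancel: "r = s" if "x \<otimes> r = x \<otimes> s" "r \<in> carrier R" "s \<in> carrier R" for r s
    proof -
      have "x \<otimes> (r \<ominus> s) = \<zero>"
        using that xy by (simp add: R.minus_eq R.r_distr R.r_minus R.r_neg)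
      then have "r \<ominus> s = \<zero>"
        using x False that by (metis R.minus_closed)
      then show ?thesis
        using that by simp
    qed
    have "\<exists>n\<in>carrier M. \<forall>f\<in>dual_space R M. y \<otimes> f (p m) = x \<otimes> f n" if m: "m \<in> carrier M" for m
    proof -
      \<comment> \<open>The quotient of \<open>y f(p m)\<close> by \<open>x\<close>. It is unique by
        \<open>cancel\<close>, and this uniqueness, in the form \<open>\<Phi>_eqI\<close>, yields
        the linearity of \<open>\<Phi>\<close>.\<close>
      define \<Phi> where "\<Phi> f = (SOME r. r \<in> carrier R \<and> y \<otimes> f (p m) = x \<otimes> r)" for f
      have \<Phi>: "\<Phi> f \<in> carrier R" "y \<otimes> f (p m) = x \<otimes> \<Phi> f" if "f \<in> dual_space R M" for f
        using div[OF that m] unfolding \<Phi>_def Bex_def by (metis (mono_tags, lifting) someI_ex)+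
      have \<Phi>_eqI: "\<Phi> f = r" if "r \<in> carrier R" "f \<in> dual_space R M" "y \<otimes> f (p m) = x \<otimes> r" for f r
        using cancel[of "\<Phi> f" r] \<Phi>[of f] that by simp
      have dsp: "f (p m) \<in> carrier R" if "f \<in> dual_space R M" for f
        using dual_spaceD(1)[OF that] pM m by auto
      obtain n where n: "n \<in> carrier M" "\<And>f. f \<in> dual_space R M \<Longrightarrow> \<Phi> f = f n"
      proof (rule reflexive_represents[OF refl, of \<Phi>])
        fix f g assume fg: "f \<in> dual_space R M" "g \<in> dual_space R M"
        have "(\<lambda>x\<in>carrier M. f x \<oplus> g x) \<in> dual_space R M"
          by (rule dual_space_restrictI)
            (use fg in \<open>auto simp: module_axioms dual_spaceD R.r_distr R.add.m_ac\<close>)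
        then show "\<Phi> (\<lambda>x\<in>carrier M. f x \<oplus> g x) = \<Phi> f \<oplus> \<Phi> g"
          using fg m \<Phi> xy by (intro \<Phi>_eqI) (auto simp: pM dsp R.r_distr)
      next
        fix a f assume af: "a \<in> carrier R" "f \<in> dual_space R M"
        then show "\<Phi> (\<lambda>x\<in>carrier M. a \<otimes> f x) = a \<otimes> \<Phi> f"
          using \<Phi> xy m by (intro \<Phi>_eqI) (auto simp: pM dsp R.m_lcomm[of _ a] dual_space_smult)
      qed (use \<Phi> in auto)
      then show ?thesis
        using \<Phi> by auto
    qed
    then obtain v where v: "v m \<in> carrier M" "f \<in> dual_space R M \<Longrightarrow> y \<otimes> f (p m) = x \<otimes> f (v m)"
      if "m \<in> carrier M" for f m
      by metis
    \<comment> \<open>The values of all functionals determine \<open>v m\<close>, so linearity of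
      \<open>v\<close> may be checked after applying each functional and multiplying by
      \<open>x\<close>.\<close>
    have v_eqI: "v m = n"
      if "m \<in> carrier M" "n \<in> carrier M" "\<And>f. f \<in> dual_space R M \<Longrightarrow> y \<otimes> f (p m) = x \<otimes> f n" for m n
    proof (rule reflexive_separates[OF refl])
      fix f assume "f \<in> dual_space R M"
      then show "f (v m) = f n"
        using cancel[of "f (v m)" "f n"] v that by (auto simp: dual_spaceD(1))
    qed (use that v in auto)
    have "restrict v (carrier M) \<in> mod_hom R M M"
    proof (rule mod_hom_restrictI)
      fix a b assume "a \<in> carrier M" "b \<in> carrier M"
      then show "v (a \<oplus>\<^bsub>M\<^esub> b) = v a \<oplus>\<^bsub>M\<^esub> v b"
        using v pM xy by (intro v_eqI) (auto simp: mod_homD(2)[OF p] dual_spaceD R.r_distr)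
    next
      fix a m assume "a \<in> carrier R" "m \<in> carrier M"
      then show "v (a \<odot>\<^bsub>M\<^esub> m) = a \<odot>\<^bsub>M\<^esub> v m"
        using v pM xy by (intro v_eqI) (auto simp: mod_homD(3)[OF p] dual_spaceD R.m_lcomm[of _ a])
    qed (use v module_axioms in auto)
    moreover have "y \<odot>\<^bsub>M\<^esub> p m = x \<odot>\<^bsub>M\<^esub> v m" if "m \<in> carrier M" for m
      using that v by (intro *) auto
    ultimately show ?thesis
      by (intro that[of "restrict v (carrier M)"]) auto
  qed
qed

section \<open>Free summands\<close>

context module
begin

lemma zero_submodule: "submodule {\<zero>\<^bsub>M\<^esub>} R M"
  by (rule submoduleI) auto

lemma generated_submodule_empty: "generated_submodule R M {} = {\<zero>\<^bsub>M\<^esub>}"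
  using generated_submodule_minimal[OF zero_submodule, of "{}"]
    submodule_zero[OF generated_submodule_submodule[of "{}"]] by auto

lemma preimage_submodule:
  assumes f: "f \<in> mod_hom R M N" and "module R N" and K: "submodule K R N"
  shows "submodule {x \<in> carrier M. f x \<in> K} R M"
proof -
  interpret N: module R N by fact
  have minus: "f (\<ominus>\<^bsub>M\<^esub> a) = \<ominus>\<^bsub>N\<^esub> f a" if "a \<in> carrier M" for a
    using mod_homD(1,3)[OF f] that smult_l_minus[of \<one> a] N.smult_l_minus[of \<one> "f a"]
    by (metis N.smult_one R.add.inv_closed R.one_closed smult_one)
  show ?thesis
    by (rule submoduleI)
      (use mod_homD[OF f] mod_hom_zero[OF f \<open>module R N\<close>] N.submoduleE[OF K] N.submodule_zero[OF K]
        in \<open>auto simp: minus\<close>)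
qed

lemma image_submodule:
  assumes f: "f \<in> mod_hom R M N" and "module R N"
  shows "submodule (f ` carrier M) R N"
proof -
  interpret N: module R N by fact
  have smult: "a \<odot>\<^bsub>N\<^esub> b \<in> f ` carrier M" if "a \<in> carrier R" "b \<in> f ` carrier M" for a b
    using that mod_homD(3)[OF f, symmetric] by auto
  show ?thesis
  proof (rule N.submoduleI)
    show sub: "f ` carrier M \<subseteq> carrier N"
      using mod_homD(1)[OF f] by auto
    show "\<zero>\<^bsub>N\<^esub> \<in> f ` carrier M"
      using mod_hom_zero[OF assms] by force
    show "\<ominus>\<^bsub>N\<^esub> a \<in> f ` carrier M" if "a \<in> f ` carrier M" for a
      using smult[of "\<ominus> \<one>" a] that sub by (auto simp: N.smult_l_minus)
    show "a \<oplus>\<^bsub>N\<^esub> b \<in> f ` carrier M" if "a \<in> f ` carrier M" "b \<in> f ` carrier M" for a b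
      using that mod_homD(2)[OF f, symmetric] by auto
  qed (rule smult)
qed

lemma dual_space_mod_hom: "dual_space R M = mod_hom R M (regular_module R)"
  by (simp add: dual_space_def dual_module_def Hom_module_def)

text \<open>Since \<open>f(a m) = a\<close>, the multiples of \<open>m\<close> form a free module
  with basis \<open>m\<close>, complemented by the kernel of \<open>f\<close>: subtract
  \<open>f(x) m\<close> from \<open>x\<close>.\<close>

lemma free_summand_of_functional:
  assumes f: "f \<in> dual_space R M" and m: "m \<in> carrier M" "f m = \<one>" and nontriv: "\<one> \<noteq> \<zero>"
  shows "has_free_summand R M"
proof -
  define F where "F = (\<lambda>a. a \<odot>\<^bsub>M\<^esub> m) ` carrier R"
  define N where "N = {x \<in> carrier M. f x \<in> {\<zero>}}"
  have fam: "f (a \<odot>\<^bsub>M\<^esub> m) = a" if "a \<in> carrier R" for a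
    using dual_spaceD(3)[OF f that] m that by simp
  have subF: "submodule F R M"
  proof (rule submoduleI)
    show "\<zero>\<^bsub>M\<^esub> \<in> F"
      unfolding F_def using m by (intro image_eqI[of _ _ \<zero>]) auto
    show "\<ominus>\<^bsub>M\<^esub> a \<in> F" if "a \<in> F" for a
      using that m by (auto simp: F_def smult_l_minus intro!: image_eqI[of _ _ "\<ominus> b" for b])
    show "a \<oplus>\<^bsub>M\<^esub> b \<in> F" if "a \<in> F" "b \<in> F" for a b
      using that m by (auto simp: F_def simp flip: smult_l_distr)
    show "a \<odot>\<^bsub>M\<^esub> b \<in> F" if "a \<in> carrier R" "b \<in> F" for a b
      using that m by (auto simp: F_def simp flip: smult_assoc1)
  qed (use m in \<open>auto simp: F_def\<close>)
  have subN: "submodule N R M"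
    unfolding N_def
    using preimage_submodule[OF f[unfolded dual_space_mod_hom] regular_module_module[OF R.is_cring]
        module.zero_submodule[OF regular_module_module[OF R.is_cring]]]
    by (simp add: regular_module_def)
  have mF: "m \<in> F"
    unfolding F_def using m by (intro image_eqI[of _ _ \<one>]) auto
  have "F <+>\<^bsub>M\<^esub> N = carrier M"
  proof
    show "F <+>\<^bsub>M\<^esub> N \<subseteq> carrier M"
      using submoduleE(1)[OF subF] submoduleE(1)[OF subN] by (rule M.set_add_closed)
    show "carrier M \<subseteq> F <+>\<^bsub>M\<^esub> N"
    proof
      fix x assume x: "x \<in> carrier M"
      have fx: "f x \<in> carrier R" using dual_spaceD(1)[OF f x] .
      let ?n = "(\<ominus> f x) \<odot>\<^bsub>M\<^esub> m \<oplus>\<^bsub>M\<^esub> x"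
      have "f ?n = \<zero>"
        using dual_spaceD(2)[OF f, of "(\<ominus> f x) \<odot>\<^bsub>M\<^esub> m" x] fam[of "\<ominus> f x"] x m fx
        by (simp add: R.l_neg)
      then have "?n \<in> N"
        using x m fx by (simp add: N_def)
      moreover have "x = f x \<odot>\<^bsub>M\<^esub> m \<oplus>\<^bsub>M\<^esub> ?n"
        using x m fx by (simp add: smult_l_minus M.r_neg1 M.r_neg2)
      moreover have "f x \<odot>\<^bsub>M\<^esub> m \<in> F"
        using fx by (auto simp: F_def)
      ultimately show "x \<in> F <+>\<^bsub>M\<^esub> N"
        unfolding set_add_def' by blast
    qed
  qed
  moreover have "F \<inter> N = {\<zero>\<^bsub>M\<^esub>}"
    using submodule_zero[OF subF] submodule_zero[OF subN] m by (auto simp: F_def N_def fam)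
  moreover have "F \<noteq> {\<zero>\<^bsub>M\<^esub>}"
    using mF m dual_space_zero[OF f] nontriv by auto
  moreover have "free_module R (M\<lparr>carrier := F\<rparr>)"
  proof -
    interpret F: module R "M\<lparr>carrier := F\<rparr>"
      using submodule.submodule_is_module[OF subF module_axioms] .
    have "linearly_independent R (M\<lparr>carrier := F\<rparr>) {m}"
      unfolding linearly_independent_def
    proof (intro allI ballI impI)
      fix A c b
      assume A: "A \<subseteq> {m}" "c \<in> A \<rightarrow> carrier R" "b \<in> A"
        and eq: "(\<Oplus>\<^bsub>M\<lparr>carrier := F\<rparr>\<^esub>b\<in>A. c b \<odot>\<^bsub>M\<lparr>carrier := F\<rparr>\<^esub> b) = \<zero>\<^bsub>M\<lparr>carrier := F\<rparr>\<^esub>"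
      then have Am: "A = {m}" "b = m" "c m \<in> carrier R" by auto
      have "c m \<odot>\<^bsub>M\<^esub> m = \<zero>\<^bsub>M\<^esub>"
        using eq Am F.smult_closed[of "c m" m] mF m by (simp add: F.M.finsum_insert)
      then show "c b = \<zero>"
        using fam[of "c m"] Am dual_space_zero[OF f] by simp
    qed
    moreover have "generated_submodule R (M\<lparr>carrier := F\<rparr>) {m} = F"
    proof
      have sub: "submodule (generated_submodule R (M\<lparr>carrier := F\<rparr>) {m}) R (M\<lparr>carrier := F\<rparr>)"
        using mF by (intro F.generated_submodule_submodule) auto
      then show "generated_submodule R (M\<lparr>carrier := F\<rparr>) {m} \<subseteq> F"
        using F.submoduleE(1) by fastforce
      show "F \<subseteq> generated_submodule R (M\<lparr>carrier := F\<rparr>) {m}"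
        using F.submoduleE(4)[OF sub] F.generated_submodule_superset[of "{m}"] by (auto simp: F_def)
    qed
    ultimately show ?thesis
      using mF by (auto simp: free_module_def module_basis_def)
  qed
  ultimately show ?thesis
    using subF subN by (auto simp: has_free_summand_def)
qed

end

section \<open>Functionals over a local ring and the implication for free summands\<close>

locale local_noetherian_module = R?: local_noetherian_ring R + module R M
  for R (structure) and M (structure)
begin

text \<open>A value outside \<open>\<mm>\<close> is a unit and can be scaled to one. Hence on a
  module without free summand all functionals take values in \<open>\<mm>\<close>.\<close>

lemma functional_normalize:
  assumes "f \<in> dual_space R M" "m \<in> carrier M" "f m \<notin> \<mm>"
  obtains g where "g \<in> dual_space R M" "g m = \<one>\<^bsub>R\<^esub>"
proof -
  obtain u where "u \<in> carrier R" "u \<otimes>\<^bsub>R\<^esub> f m = \<one>\<^bsub>R\<^esub>"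
    using unit_if_notin_max_ideal[of "f m"] dual_spaceD(1)[OF assms(1,2)] assms(3) by auto
  then show thesis
    using that[OF dual_space_smult[OF assms(1)]] assms(2) by simp
qed

lemma free_summand_of_endomorphisms:
  assumes depth: "depth R \<le> 1" and refl: "reflexive_module R M"
    and E: "has_free_summand R (End_module R M)"
  shows "has_free_summand R M"
proof (rule ccontr)
  assume no: "\<not> has_free_summand R M"
  have \<mm>: "f m \<in> \<mm>" if "f \<in> dual_space R M" "m \<in> carrier M" for f m
    using functional_normalize[OF that] free_summand_of_functional that(2) no one_notin_max_ideal
    by (metis max.zero_closed)
  obtain x y where xy: "x \<in> carrier R" "y \<in> carrier R"
      "x = \<zero>\<^bsub>R\<^esub> \<or> (\<forall>r\<in>carrier R. x \<otimes>\<^bsub>R\<^esub> r = \<zero>\<^bsub>R\<^esub> \<longrightarrow> r = \<zero>\<^bsub>R\<^esub>)"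
    and y: "\<And>r. r \<in> carrier R \<Longrightarrow> y \<noteq> x \<otimes>\<^bsub>R\<^esub> r"
    and div: "\<And>w. w \<in> \<mm> \<Longrightarrow> \<exists>r\<in>carrier R. y \<otimes>\<^bsub>R\<^esub> w = x \<otimes>\<^bsub>R\<^esub> r"
    by (rule regular_or_zero_socle[OF depth]) blast
  have id: "(\<lambda>m\<in>carrier M. m) \<in> mod_hom R M M"
    by (rule mod_hom_restrictI) (auto simp: module_axioms)
  obtain v where v: "v \<in> mod_hom R M M"
      "\<And>m. m \<in> carrier M \<Longrightarrow> y \<odot>\<^bsub>M\<^esub> (\<lambda>m\<in>carrier M. m) m = x \<odot>\<^bsub>M\<^esub> v m"
    by (rule reflexive_divide_endomorphism[OF refl id xy]) (use div \<mm> in auto)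
  let ?E = "End_module R M"
  interpret E: module R ?E
    by (intro Hom_module_module module_axioms)
  obtain F N B where sub: "submodule F R ?E" "submodule N R ?E"
    and FN: "F <+>\<^bsub>?E\<^esub> N = carrier ?E" "F \<inter> N = {\<zero>\<^bsub>?E\<^esub>}" "F \<noteq> {\<zero>\<^bsub>?E\<^esub>}"
    and B: "module_basis R (?E\<lparr>carrier := F\<rparr>) B"
    using E by (auto simp: has_free_summand_def free_module_def)
  interpret F: module R "?E\<lparr>carrier := F\<rparr>"
    using submodule.submodule_is_module[OF sub(1) E.module_axioms] .
  have "B \<noteq> {}"
    using B F.generated_submodule_empty FN(3) by (auto simp: module_basis_def)
  then obtain h where h: "h \<in> B" by auto
  then have hF: "h \<in> F"
    using B by (auto simp: module_basis_def)
  then have hE: "h \<in> carrier ?E"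
    using E.submoduleE(1)[OF sub(1)] by auto
  then have hM: "h \<in> mod_hom R M M"
    by (simp add: Hom_module_def)
  \<comment> \<open>The composite of \<open>v\<close> and \<open>h\<close> satisfies
    \<open>y h = x g\<close>, but it is only known to lie in the endomorphism module, not in the
    free summand \<open>F\<close>.\<close>
  define g where "g = (\<lambda>m\<in>carrier M. v (h m))"
  have gM: "g \<in> mod_hom R M M"
    unfolding g_def
    by (rule mod_hom_restrictI) (use mod_homD[OF v(1)] mod_homD[OF hM] module_axioms in auto)
  have yh: "y \<odot>\<^bsub>?E\<^esub> h = x \<odot>\<^bsub>?E\<^esub> g"
    using v(2) mod_homD(1)[OF hM] by (auto simp: Hom_module_def g_def intro!: restrict_ext)
  have "g \<in> F <+>\<^bsub>?E\<^esub> N"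
    using gM FN(1) by (simp add: Hom_module_def)
  then obtain g' n where g': "g' \<in> F" "n \<in> N" "g = g' \<oplus>\<^bsub>?E\<^esub> n"
    unfolding set_add_def' by blast
  have car: "g' \<in> carrier ?E" "n \<in> carrier ?E"
    using g' E.submoduleE(1)[OF sub(1)] E.submoduleE(1)[OF sub(2)] by auto
  \<comment> \<open>The element \<open>x n\<close> lies in \<open>N\<close> and, being
    \<open>y h - x g'\<close>, also in \<open>F\<close>, so it is zero. This replaces
    \<open>g\<close> by its component \<open>g'\<close> in \<open>F\<close>.\<close>
  have "x \<odot>\<^bsub>?E\<^esub> n = y \<odot>\<^bsub>?E\<^esub> h \<oplus>\<^bsub>?E\<^esub> \<ominus>\<^bsub>?E\<^esub> (x \<odot>\<^bsub>?E\<^esub> g')"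
    unfolding yh g'(3) using car xy
    by (simp add: E.smult_r_distr E.M.a_comm[of "x \<odot>\<^bsub>?E\<^esub> g'"] E.M.a_assoc E.M.r_neg)
  moreover have "\<dots> \<in> F"
    using sub(1) hF g'(1) xy by (intro E.submoduleE(3-5)) auto
  moreover have "x \<odot>\<^bsub>?E\<^esub> n \<in> N"
    using sub(2) g'(2) xy by (intro E.submoduleE(4)) auto
  ultimately have "y \<odot>\<^bsub>?E\<^esub> h \<oplus>\<^bsub>?E\<^esub> \<ominus>\<^bsub>?E\<^esub> (x \<odot>\<^bsub>?E\<^esub> g') = \<zero>\<^bsub>?E\<^esub>"
    using FN(2) by (metis Int_iff singletonD)
  then have "y \<odot>\<^bsub>?E\<^esub> h = x \<odot>\<^bsub>?E\<^esub> g'"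
    using car xy hE by (metis E.M.minus_equality E.M.minus_minus E.smult_closed E.M.a_inv_closed)
  \<comment> \<open>As a basis element, \<open>h\<close> has the single coefficient one; comparing
    coordinates in \<open>y h = x g'\<close> puts \<open>y\<close> into \<open>x R\<close>.\<close>
  moreover have "(\<Oplus>\<^bsub>?E\<lparr>carrier := F\<rparr>\<^esub>b\<in>{h}. \<one>\<^bsub>R\<^esub> \<odot>\<^bsub>?E\<lparr>carrier := F\<rparr>\<^esub> b) = h"
    using hF hE by (subst F.M.finsum_insert) auto
  ultimately have "\<exists>d\<in>carrier R. y \<otimes>\<^bsub>R\<^esub> \<one>\<^bsub>R\<^esub> = x \<otimes>\<^bsub>R\<^esub> d"
    using h g'(1) xy by (intro F.lincomb_divisible[OF B, of "{h}" "\<lambda>_. \<one>\<^bsub>R\<^esub>" _ _ g' h]) auto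
  then show False
    using y xy by auto
qed

end

section \<open>Freeness\<close>

text \<open>The submodule \<open>I s + N\<close>. It serves Nakayama's argument with
  \<open>N\<close> the span of the generators other than \<open>s\<close>, once for
  \<open>I = R\<close> and once for \<open>I = \<mm>\<close>.\<close>

lemma (in module) ideal_multiple_plus_submodule:
  assumes I: "ideal I R" and N: "submodule N R M" and s: "s \<in> carrier M"
  shows "submodule {c \<odot>\<^bsub>M\<^esub> s \<oplus>\<^bsub>M\<^esub> w | c w. c \<in> I \<and> w \<in> N} R M" (is "submodule ?W R M")
proof -
  interpret I: ideal I R by fact
  have NM: "w \<in> carrier M" if "w \<in> N" for w
    using submoduleE(1)[OF N] that by auto
  have smult: "a \<odot>\<^bsub>M\<^esub> b \<in> ?W" if a: "a \<in> carrier R" and b: "b \<in> ?W" for a b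
  proof -
    from b obtain c w where cw: "c \<in> I" "w \<in> N" "b = c \<odot>\<^bsub>M\<^esub> s \<oplus>\<^bsub>M\<^esub> w" by auto
    then have "a \<odot>\<^bsub>M\<^esub> b = (a \<otimes> c) \<odot>\<^bsub>M\<^esub> s \<oplus>\<^bsub>M\<^esub> a \<odot>\<^bsub>M\<^esub> w"
      using a s NM by (simp add: smult_r_distr smult_assoc1)
    moreover have "a \<otimes> c \<in> I" "a \<odot>\<^bsub>M\<^esub> w \<in> N"
      using cw a I.I_l_closed submoduleE(4)[OF N] by auto
    ultimately show ?thesis by blast
  qed
  have sub: "?W \<subseteq> carrier M"
    using s NM by auto
  show ?thesis
  proof (rule submoduleI)
    have "\<zero>\<^bsub>M\<^esub> = \<zero> \<odot>\<^bsub>M\<^esub> s \<oplus>\<^bsub>M\<^esub> \<zero>\<^bsub>M\<^esub>"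
      using s by simp
    then show "\<zero>\<^bsub>M\<^esub> \<in> ?W"
      using I.zero_closed submodule_zero[OF N] by blast
    show "\<ominus>\<^bsub>M\<^esub> a \<in> ?W" if "a \<in> ?W" for a
    proof -
      have "a \<in> carrier M" using that sub by blast
      then show ?thesis
        using smult[OF _ that, of "\<ominus> \<one>"] by (simp add: smult_l_minus)
    qed
    fix a b assume "a \<in> ?W" "b \<in> ?W"
    then obtain c w c' w' where *: "c \<in> I" "w \<in> N" "c' \<in> I" "w' \<in> N"
        "a = c \<odot>\<^bsub>M\<^esub> s \<oplus>\<^bsub>M\<^esub> w" "b = c' \<odot>\<^bsub>M\<^esub> s \<oplus>\<^bsub>M\<^esub> w'" by auto
    then have "a \<oplus>\<^bsub>M\<^esub> b = (c \<oplus> c') \<odot>\<^bsub>M\<^esub> s \<oplus>\<^bsub>M\<^esub> (w \<oplus>\<^bsub>M\<^esub> w')"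
      using s NM by (simp add: smult_l_distr M.add.m_ac)
    moreover have "c \<oplus> c' \<in> I" "w \<oplus>\<^bsub>M\<^esub> w' \<in> N"
      using * I.a_closed submoduleE(5)[OF N] by auto
    ultimately show "a \<oplus>\<^bsub>M\<^esub> b \<in> ?W"
      by blast
  qed (fact sub smult)+
qed

section \<open>Idempotents with free kernel and the descent on generators of the image\<close>

context module
begin

text \<open>A state of the descent: \<open>M\<close> is the direct sum of the image and the kernel
  of the idempotent \<open>p\<close>, the kernel is free with basis \<open>B\<close>, and
  \<open>G\<close> generates the part still to be treated. The set \<open>G\<close> need not be a
  minimal generating set.\<close>

definition splitting :: "('c \<Rightarrow> 'c) \<Rightarrow> 'c set \<Rightarrow> 'c set \<Rightarrow> bool"
  where "splitting p G B \<longleftrightarrow>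
    p \<in> mod_hom R M M \<and> (\<forall>m\<in>carrier M. p (p m) = p m) \<and>
    finite G \<and> G \<subseteq> carrier M \<and> generated_submodule R M G = p ` carrier M \<and>
    B \<subseteq> carrier M \<and> linearly_independent R M B \<and>
    generated_submodule R M B = {m \<in> carrier M. p m = \<zero>\<^bsub>M\<^esub>}"

lemma kernel_submodule:
  "p \<in> mod_hom R M M \<Longrightarrow> submodule {m \<in> carrier M. p m = \<zero>\<^bsub>M\<^esub>} R M"
  using preimage_submodule[OF _ module_axioms zero_submodule] by simp

lemma splitting_fixes:
  assumes "splitting p G B" "s \<in> generated_submodule R M G"
  shows "p s = s"
  using assms by (auto simp: splitting_def)

text \<open>Because \<open>f s = 1\<close>, subtracting \<open>f(m) s\<close> from \<open>m\<close>
  is the projection along \<open>s\<close> onto the kernel of \<open>f\<close>. Its composite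
  \<open>q\<close> with \<open>p\<close> is idempotent, and its kernel is that of \<open>p\<close>
  enlarged by the free summand spanned by \<open>s\<close>.\<close>

lemma splitting_move_to_kernel:
  assumes sp: "splitting p G B" and s: "s \<in> G" and f: "f \<in> dual_space R M" "f s = \<one>"
    and nontriv: "\<one> \<noteq> \<zero>"
  obtains q where "splitting q (q ` (G - {s})) (insert s B)"
proof -
  have p: "p \<in> mod_hom R M M" "\<And>m. m \<in> carrier M \<Longrightarrow> p (p m) = p m"
    and G: "finite G" "G \<subseteq> carrier M" "generated_submodule R M G = p ` carrier M"
    and B: "B \<subseteq> carrier M" "linearly_independent R M B"
      "generated_submodule R M B = {m \<in> carrier M. p m = \<zero>\<^bsub>M\<^esub>}"
    using sp by (auto simp: splitting_def)
  note pM = mod_homD(1)[OF p(1)] and fM = dual_spaceD(1)[OF f(1)]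
  have sM: "s \<in> carrier M" and ps: "p s = s"
    using s G splitting_fixes[OF sp, of s] generated_submodule_superset[of G] by auto
  define q where "q = (\<lambda>m\<in>carrier M. p m \<oplus>\<^bsub>M\<^esub> (\<ominus> f (p m)) \<odot>\<^bsub>M\<^esub> s)"
  have q: "q m = p m \<oplus>\<^bsub>M\<^esub> (\<ominus> f (p m)) \<odot>\<^bsub>M\<^esub> s" if "m \<in> carrier M" for m
    using that by (simp add: q_def)
  have q_hom: "q \<in> mod_hom R M M"
    unfolding q_def
  proof (rule mod_hom_restrictI)
    fix m n assume "m \<in> carrier M" "n \<in> carrier M"
    then show "p (m \<oplus>\<^bsub>M\<^esub> n) \<oplus>\<^bsub>M\<^esub> (\<ominus> f (p (m \<oplus>\<^bsub>M\<^esub> n))) \<odot>\<^bsub>M\<^esub> s =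
        p m \<oplus>\<^bsub>M\<^esub> (\<ominus> f (p m)) \<odot>\<^bsub>M\<^esub> s \<oplus>\<^bsub>M\<^esub> (p n \<oplus>\<^bsub>M\<^esub> (\<ominus> f (p n)) \<odot>\<^bsub>M\<^esub> s)"
      using pM fM sM
      by (simp add: mod_homD(2)[OF p(1)] dual_spaceD(2)[OF f(1)] R.minus_add smult_l_distr M.add.m_ac)
  next
    fix a m assume "a \<in> carrier R" "m \<in> carrier M"
    then show "p (a \<odot>\<^bsub>M\<^esub> m) \<oplus>\<^bsub>M\<^esub> (\<ominus> f (p (a \<odot>\<^bsub>M\<^esub> m))) \<odot>\<^bsub>M\<^esub> s =
        a \<odot>\<^bsub>M\<^esub> (p m \<oplus>\<^bsub>M\<^esub> (\<ominus> f (p m)) \<odot>\<^bsub>M\<^esub> s)"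
      using pM fM sM
      by (simp add: mod_homD(3)[OF p(1)] dual_spaceD(3)[OF f(1)] smult_r_distr R.r_minus
          flip: smult_assoc1)
  qed (use pM fM sM module_axioms in auto)
  note qM = mod_homD(1)[OF q_hom]
  have pq: "p (q m) = q m" if "m \<in> carrier M" for m
    using that pM fM sM by (simp add: q mod_homD(2,3)[OF p(1)] p(2) ps)
  have fq: "f (q m) = \<zero>" if "m \<in> carrier M" for m
    using that pM fM sM f(2) by (simp add: q dual_spaceD(2,3)[OF f(1)] R.r_neg)
  have qq: "q (q m) = q m" if "m \<in> carrier M" for m
    using that qM sM by (simp add: q[of "q m"] pq fq)
  have qp: "q (p m) = q m" if "m \<in> carrier M" for m
    using that pM by (simp add: q p(2))
  have qs: "q s = \<zero>\<^bsub>M\<^esub>"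
    using sM by (simp add: q ps f(2) smult_l_minus M.r_neg)
  let ?G = "q ` (G - {s})"
  have GM: "?G \<subseteq> carrier M"
    using G qM by auto
  have gen_G: "generated_submodule R M ?G = q ` carrier M"
  proof
    show "generated_submodule R M ?G \<subseteq> q ` carrier M"
      using G by (intro generated_submodule_minimal image_submodule[OF q_hom module_axioms]) auto
    \<comment> \<open>This preimage contains all of \<open>G\<close>, including \<open>s\<close>
      because \<open>q s = 0\<close>. So it contains \<open>p M\<close>, and
      \<open>q (p m) = q m\<close> gives the claim.\<close>
    have "submodule {m \<in> carrier M. q m \<in> generated_submodule R M ?G} R M" (is "submodule ?P R M")
      by (intro preimage_submodule[OF q_hom module_axioms] generated_submodule_submodule GM)
    moreover have "G \<subseteq> ?P"
    proof
      fix t assume "t \<in> G"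
      then show "t \<in> ?P"
        using G qs submodule_zero[OF generated_submodule_submodule[OF GM]]
          generated_submodule_superset[of ?G] by (cases "t = s") auto
    qed
    ultimately have "p ` carrier M \<subseteq> ?P"
      using generated_submodule_minimal G(3) by blast
    then show "q ` carrier M \<subseteq> generated_submodule R M ?G"
      using qp by force
  qed
  have B_ker: "B \<subseteq> {m \<in> carrier M. p m = \<zero>\<^bsub>M\<^esub>}"
    using generated_submodule_superset[of B] B(3) by simp
  have s_notin: "s \<notin> B"
    using B_ker ps f dual_space_zero[OF f(1)] nontriv by auto
  have li: "linearly_independent R M (insert s B)"
    unfolding linearly_independent_def
  proof (intro allI ballI impI)
    fix A c b
    assume A: "A \<subseteq> insert s B" "c \<in> A \<rightarrow> carrier R" "finite A"
      and eq: "(\<Oplus>\<^bsub>M\<^esub>b\<in>A. c b \<odot>\<^bsub>M\<^esub> b) = \<zero>\<^bsub>M\<^esub>" and b: "b \<in> A"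
    let ?S = "\<Oplus>\<^bsub>M\<^esub>b\<in>A - {s}. c b \<odot>\<^bsub>M\<^esub> b"
    have S_ker: "?S \<in> {m \<in> carrier M. p m = \<zero>\<^bsub>M\<^esub>}"
    proof (rule submodule_finsum[OF kernel_submodule[OF p(1)]])
      show "(\<lambda>b. c b \<odot>\<^bsub>M\<^esub> b) \<in> A - {s} \<rightarrow> {m \<in> carrier M. p m = \<zero>\<^bsub>M\<^esub>}"
        using A B_ker submoduleE(4)[OF kernel_submodule[OF p(1)]] by blast
    qed (use A in auto)
    have SM: "?S \<in> carrier M" and pS: "p ?S = \<zero>\<^bsub>M\<^esub>"
      using S_ker by auto
    have "(s \<in> A \<longrightarrow> c s = \<zero>) \<and> ?S = \<zero>\<^bsub>M\<^esub>"
    proof (cases "s \<in> A")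
      case True
      then have cs: "c s \<in> carrier R" using A by auto
      have "(\<Oplus>\<^bsub>M\<^esub>b\<in>insert s (A - {s}). c b \<odot>\<^bsub>M\<^esub> b) = c s \<odot>\<^bsub>M\<^esub> s \<oplus>\<^bsub>M\<^esub> ?S"
        by (rule M.finsum_insert) (use A B(1) sM cs in \<open>auto simp: Pi_iff subset_iff\<close>)
      then have split: "c s \<odot>\<^bsub>M\<^esub> s \<oplus>\<^bsub>M\<^esub> ?S = \<zero>\<^bsub>M\<^esub>"
        using eq True by (simp add: insert_absorb)
      \<comment> \<open>Applying \<open>p\<close> and then \<open>f\<close> isolates the coefficient
        of \<open>s\<close>: \<open>p\<close> kills the part over \<open>B\<close> and fixes
        \<open>s\<close>.\<close>
      have "f (p (c s \<odot>\<^bsub>M\<^esub> s \<oplus>\<^bsub>M\<^esub> ?S)) = c s"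
        using cs sM SM pS ps f(2) by (simp add: mod_homD(2,3)[OF p(1)] dual_spaceD(3)[OF f(1)])
      then have "c s = \<zero>"
        using split mod_hom_zero[OF p(1) module_axioms] dual_space_zero[OF f(1)] by simp
      then show ?thesis
        using split sM SM by simp
    qed (use eq in simp)
    moreover have "\<forall>b\<in>A - {s}. c b = \<zero>"
      using B(2)[unfolded linearly_independent_def, rule_format, of "A - {s}" c] A calculation by auto
    ultimately show "c b = \<zero>"
      using b by (cases "b = s") auto
  qed
  have gen_B: "generated_submodule R M (insert s B) = {m \<in> carrier M. q m = \<zero>\<^bsub>M\<^esub>}"
  proof
    have "q m = \<zero>\<^bsub>M\<^esub>" if "m \<in> carrier M" "p m = \<zero>\<^bsub>M\<^esub>" for m
      using that sM dual_space_zero[OF f(1)] by (simp add: q)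
    then show "generated_submodule R M (insert s B) \<subseteq> {m \<in> carrier M. q m = \<zero>\<^bsub>M\<^esub>}"
      using B_ker sM qs by (intro generated_submodule_minimal kernel_submodule q_hom) auto
    have sub: "submodule (generated_submodule R M (insert s B)) R M"
      using sM B(1) by (intro generated_submodule_submodule) auto
    have ker: "{m \<in> carrier M. p m = \<zero>\<^bsub>M\<^esub>} \<subseteq> generated_submodule R M (insert s B)"
      unfolding B(3)[symmetric]
      using generated_submodule_superset[of "insert s B"] by (intro generated_submodule_minimal sub) auto
    show "{m \<in> carrier M. q m = \<zero>\<^bsub>M\<^esub>} \<subseteq> generated_submodule R M (insert s B)"
    proof
      fix m assume "m \<in> {m \<in> carrier M. q m = \<zero>\<^bsub>M\<^esub>}"
      then have m: "m \<in> carrier M" "q m = \<zero>\<^bsub>M\<^esub>" by auto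
      \<comment> \<open>Decompose \<open>m\<close> as \<open>(m - p m) + p m\<close>. The first term
        lies in the kernel of \<open>p\<close>, and \<open>q m = 0\<close> makes the second one
        equal to \<open>f(p m) s\<close>.\<close>
      let ?k = "m \<oplus>\<^bsub>M\<^esub> (\<ominus> \<one>) \<odot>\<^bsub>M\<^esub> p m"
      have "p ?k = \<zero>\<^bsub>M\<^esub>"
        using m pM mod_homD(2)[OF p(1), of m "(\<ominus> \<one>) \<odot>\<^bsub>M\<^esub> p m"] mod_homD(3)[OF p(1), of "\<ominus> \<one>" "p m"]
        by (simp add: p(2) smult_l_minus M.r_neg)
      then have "?k \<in> generated_submodule R M (insert s B)"
        using ker m pM by auto
      moreover have "f (p m) \<odot>\<^bsub>M\<^esub> s \<in> generated_submodule R M (insert s B)"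
        using submoduleE(4)[OF sub] fM pM m generated_submodule_superset[of "insert s B"] by auto
      moreover have "p m = f (p m) \<odot>\<^bsub>M\<^esub> s"
        using m pM fM sM M.minus_equality[of "p m" "(\<ominus> f (p m)) \<odot>\<^bsub>M\<^esub> s"]
        by (simp add: q smult_l_minus)
      moreover have "m = ?k \<oplus>\<^bsub>M\<^esub> p m"
        using m pM by (simp add: smult_l_minus M.a_assoc M.l_neg)
      ultimately show "m \<in> generated_submodule R M (insert s B)"
        using submoduleE(5)[OF sub] by metis
    qed
  qed
  have "splitting q ?G (insert s B)"
    unfolding splitting_def using q_hom qq G(1) GM gen_G li gen_B sM B(1) by auto
  then show thesis
    by (rule that)
qed

end

context local_noetherian_module
begin

text \<open>Nakayama's lemma for one generator: \<open>1 - c\<close> is a unit and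
  \<open>(1 - c) s = w\<close>, so \<open>s\<close> is already in the span of the others.\<close>

lemma splitting_drop_generator:
  assumes sp: "splitting p G B" and s: "s \<in> G"
    and c: "c \<in> \<mm>" and w: "w \<in> generated_submodule R M (G - {s})"
    and eq: "s = c \<odot>\<^bsub>M\<^esub> s \<oplus>\<^bsub>M\<^esub> w"
  shows "splitting p (G - {s}) B"
proof -
  let ?N = "generated_submodule R M (G - {s})"
  have G: "G \<subseteq> carrier M" using sp by (auto simp: splitting_def)
  have sM: "s \<in> carrier M" and cR: "c \<in> carrier R" using s G c by auto
  have N: "submodule ?N R M"
    using G by (intro generated_submodule_submodule) auto
  have wM: "w \<in> carrier M" using w submoduleE(1)[OF N] by auto
  have "\<one>\<^bsub>R\<^esub> \<ominus>\<^bsub>R\<^esub> c \<notin> \<mm>"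
  proof
    assume "\<one>\<^bsub>R\<^esub> \<ominus>\<^bsub>R\<^esub> c \<in> \<mm>"
    then have "(\<one>\<^bsub>R\<^esub> \<ominus>\<^bsub>R\<^esub> c) \<oplus>\<^bsub>R\<^esub> c \<in> \<mm>"
      using c by (rule max.a_closed)
    then show False
      using one_notin_max_ideal cR by (simp add: R.minus_eq R.a_assoc R.l_neg)
  qed
  then obtain u where u: "u \<in> carrier R" "u \<otimes>\<^bsub>R\<^esub> (\<one>\<^bsub>R\<^esub> \<ominus>\<^bsub>R\<^esub> c) = \<one>\<^bsub>R\<^esub>"
    using unit_if_notin_max_ideal[of "\<one>\<^bsub>R\<^esub> \<ominus>\<^bsub>R\<^esub> c"] cR by auto
  have "(\<one>\<^bsub>R\<^esub> \<ominus>\<^bsub>R\<^esub> c) \<odot>\<^bsub>M\<^esub> s = s \<oplus>\<^bsub>M\<^esub> \<ominus>\<^bsub>M\<^esub> (c \<odot>\<^bsub>M\<^esub> s)"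
    using sM cR by (simp add: R.minus_eq smult_l_distr smult_l_minus)
  also have "\<dots> = (c \<odot>\<^bsub>M\<^esub> s \<oplus>\<^bsub>M\<^esub> w) \<oplus>\<^bsub>M\<^esub> \<ominus>\<^bsub>M\<^esub> (c \<odot>\<^bsub>M\<^esub> s)"
    using eq by simp
  also have "\<dots> = w"
    using sM cR wM by (simp add: M.a_comm[of "c \<odot>\<^bsub>M\<^esub> s"] M.a_assoc M.r_neg)
  finally have "u \<odot>\<^bsub>M\<^esub> w = s"
    using u sM cR by (metis R.minus_closed R.one_closed smult_assoc1 smult_one)
  then have "s \<in> ?N"
    using submoduleE(4)[OF N u(1) w] by simp
  then have "G \<subseteq> ?N"
    using generated_submodule_superset[of "G - {s}"] by auto
  then have "generated_submodule R M G \<subseteq> ?N"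
    by (rule generated_submodule_minimal[OF N])
  moreover have "?N \<subseteq> generated_submodule R M G"
    using generated_submodule_superset[of G]
    by (intro generated_submodule_minimal generated_submodule_submodule G) auto
  ultimately show ?thesis
    using sp by (auto simp: splitting_def)
qed

text \<open>If some functional has a unit value at a generator, that generator moves to the kernel.
  Otherwise all functionals send the image of \<open>p\<close> into \<open>\<mm>\<close>, and a
  generator turns out to be redundant.\<close>

lemma splitting_smaller:
  assumes depth: "depth R \<le> 1" and refl: "reflexive_module R M"
    and E: "free_module R (End_module R M)"
    and sp: "splitting p G B" and "G \<noteq> {}"
  obtains p' G' B' where "splitting p' G' B'" "card G' < card G"
proof (cases "\<exists>s\<in>G. \<exists>f\<in>dual_space R M. f s \<notin> \<mm>")
  case True
  then obtain s f where s: "s \<in> G" and f: "f \<in> dual_space R M" "f s \<notin> \<mm>" by auto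
  have G: "G \<subseteq> carrier M" "finite G" using sp by (auto simp: splitting_def)
  obtain g where "g \<in> dual_space R M" "g s = \<one>\<^bsub>R\<^esub>"
    using functional_normalize[OF f(1) _ f(2)] s G by auto
  then obtain q where "splitting q (q ` (G - {s})) (insert s B)"
    using splitting_move_to_kernel[OF sp s] one_notin_max_ideal max.zero_closed by metis
  moreover have "card (q ` (G - {s})) < card G"
    using card_image_le[of "G - {s}" q] card_Diff1_less[OF G(2) s] G(2) by simp
  ultimately show thesis
    by (rule that)
next
  case False
  obtain s where s: "s \<in> G" using \<open>G \<noteq> {}\<close> by auto
  have p: "p \<in> mod_hom R M M" "\<And>m. m \<in> carrier M \<Longrightarrow> p (p m) = p m"
    and G: "finite G" "G \<subseteq> carrier M" "generated_submodule R M G = p ` carrier M"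
    using sp by (auto simp: splitting_def)
  have sM: "s \<in> carrier M" and ps: "p s = s"
    using s G splitting_fixes[OF sp, of s] generated_submodule_superset[of G] by auto
  have reg: "module R (regular_module R)"
    by (rule regular_module_module[OF R.is_cring])
  \<comment> \<open>\<open>regular_module R\<close> is a record different from \<open>R\<close>, so
    negation in the two must be identified before \<open>\<mm>\<close> can be seen to be a
    submodule.\<close>
  have "a_inv (regular_module R) a = \<ominus>\<^bsub>R\<^esub> a" for a
    by (simp add: regular_module_def a_inv_def m_inv_def)
  then have "submodule \<mm> R (regular_module R)"
    by (intro module.submoduleI[OF reg]) (auto simp: regular_module_def max.I_l_closed)
  \<comment> \<open>The case assumption speaks of the generators only; the preimage of
    \<open>\<mm>\<close> under \<open>f\<close> is a submodule, so it extends to their span.\<close>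
  have fp: "f (p m) \<in> \<mm>" if f: "f \<in> dual_space R M" and m: "m \<in> carrier M" for f m
  proof -
    have "submodule {x \<in> carrier M. f x \<in> \<mm>} R M"
      using f by (intro preimage_submodule[OF _ reg] \<open>submodule \<mm> R _\<close>) (simp add: dual_space_mod_hom)
    then have "generated_submodule R M G \<subseteq> {x \<in> carrier M. f x \<in> \<mm>}"
      using False f G(2) by (intro generated_submodule_minimal) auto
    then show ?thesis
      using G(3) m by auto
  qed
  obtain x y where xy: "x \<in> carrier R" "y \<in> carrier R"
      "x = \<zero>\<^bsub>R\<^esub> \<or> (\<forall>r\<in>carrier R. x \<otimes>\<^bsub>R\<^esub> r = \<zero>\<^bsub>R\<^esub> \<longrightarrow> r = \<zero>\<^bsub>R\<^esub>)"
    and y: "\<And>r. r \<in> carrier R \<Longrightarrow> y \<noteq> x \<otimes>\<^bsub>R\<^esub> r"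
    and div: "\<And>w. w \<in> \<mm> \<Longrightarrow> \<exists>r\<in>carrier R. y \<otimes>\<^bsub>R\<^esub> w = x \<otimes>\<^bsub>R\<^esub> r"
    by (rule regular_or_zero_socle[OF depth]) blast
  obtain v where v: "v \<in> mod_hom R M M"
      "\<And>m. m \<in> carrier M \<Longrightarrow> y \<odot>\<^bsub>M\<^esub> p m = x \<odot>\<^bsub>M\<^esub> v m"
    by (rule reflexive_divide_endomorphism[OF refl p(1) xy]) (use div fp in auto)
  let ?E = "End_module R M"
  interpret E: module R ?E
    by (intro Hom_module_module module_axioms)
  have yp: "y \<odot>\<^bsub>?E\<^esub> p = x \<odot>\<^bsub>?E\<^esub> v"
    using v(2) by (auto simp: Hom_module_def intro!: restrict_ext)
  have pv: "p \<in> carrier ?E" "v \<in> carrier ?E"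
    using p v by (auto simp: Hom_module_def)
  obtain C where C: "module_basis R ?E C"
    using E by (auto simp: free_module_def)
  then have CE: "C \<subseteq> carrier ?E" "p \<in> generated_submodule R ?E C"
    using pv by (auto simp: module_basis_def)
  obtain A c where A: "finite A" "A \<subseteq> C" "c \<in> A \<rightarrow> carrier R"
      "p = (\<Oplus>\<^bsub>?E\<^esub>b\<in>A. c b \<odot>\<^bsub>?E\<^esub> b)"
    by (rule E.generated_submodule_lincomb[OF CE])
  \<comment> \<open>Coordinates in \<open>y p = x v\<close> give \<open>y (c b)\<close> in
    \<open>x R\<close>; if \<open>c b\<close> were a unit, \<open>y\<close> itself would be in
    \<open>x R\<close>.\<close>
  have c\<mm>: "c b \<in> \<mm>" if b: "b \<in> A" for b
  proof (rule ccontr)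
    assume no: "c b \<notin> \<mm>"
    have cb: "c b \<in> carrier R" using b A by auto
    obtain d where d: "d \<in> carrier R" "y \<otimes>\<^bsub>R\<^esub> c b = x \<otimes>\<^bsub>R\<^esub> d"
      using E.lincomb_divisible[OF C A(1-3) xy(1,2) pv(2) _ b] yp A(4) by auto
    obtain u where u: "u \<in> carrier R" "u \<otimes>\<^bsub>R\<^esub> c b = \<one>\<^bsub>R\<^esub>"
      by (rule unit_if_notin_max_ideal[OF cb no])
    have "y = y \<otimes>\<^bsub>R\<^esub> (c b \<otimes>\<^bsub>R\<^esub> u)"
      using u xy cb by (simp add: R.m_comm)
    also have "\<dots> = x \<otimes>\<^bsub>R\<^esub> (d \<otimes>\<^bsub>R\<^esub> u)"
      using u xy cb d by (simp flip: R.m_assoc)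
    finally show False
      using y[of "d \<otimes>\<^bsub>R\<^esub> u"] d u by simp
  qed
  let ?N = "generated_submodule R M (G - {s})"
  have N: "submodule ?N R M"
    using G by (intro generated_submodule_submodule) auto
  let ?W = "\<lambda>I. {c \<odot>\<^bsub>M\<^esub> s \<oplus>\<^bsub>M\<^esub> w | c w. c \<in> I \<and> w \<in> ?N}"
  have W: "submodule (?W \<mm>) R M" "submodule (?W (carrier R)) R M"
    by (intro ideal_multiple_plus_submodule N sM max.is_ideal R.oneideal)+
  have "G \<subseteq> ?W (carrier R)"
  proof
    fix t assume t: "t \<in> G"
    show "t \<in> ?W (carrier R)"
    proof (cases "t = s")
      case True
      then have "t = \<one>\<^bsub>R\<^esub> \<odot>\<^bsub>M\<^esub> s \<oplus>\<^bsub>M\<^esub> \<zero>\<^bsub>M\<^esub>" using sM by simp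
      then show ?thesis
        using submodule_zero[OF N] R.one_closed by blast
    next
      case False
      then have "t = \<zero>\<^bsub>R\<^esub> \<odot>\<^bsub>M\<^esub> s \<oplus>\<^bsub>M\<^esub> t" "t \<in> ?N"
        using sM t G generated_submodule_superset[of "G - {s}"] by auto
      then show ?thesis
        using R.zero_closed by blast
    qed
  qed
  then have pW: "p m \<in> ?W (carrier R)" if "m \<in> carrier M" for m
    using generated_submodule_minimal[OF W(2)] G(3) that by blast
  \<comment> \<open>Evaluation at \<open>s\<close> followed by \<open>p\<close> is linear in the
    endomorphism, so it can be applied to the basis expansion of \<open>p\<close>.\<close>
  let ?ev = "\<lambda>h\<in>carrier ?E. p (h s)"
  have ev: "?ev \<in> mod_hom R ?E M"
    by (rule mod_hom_restrictI[OF _ _ _ E.module_axioms])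
      (use sM in \<open>auto simp: Hom_module_def mod_homD[OF p(1)] mod_homD(1)\<close>)
  \<comment> \<open>For a basis element \<open>b\<close>, the vector \<open>p (b s)\<close> lies in
    \<open>R s + N\<close>, and the factor \<open>c b\<close> in \<open>\<mm>\<close> moves it into
    \<open>\<mm> s + N\<close>. Summing up, \<open>s = p (p s)\<close> lies in
    \<open>\<mm> s + N\<close>.\<close>
  have "p \<in> {h \<in> carrier ?E. ?ev h \<in> ?W \<mm>}" (is "p \<in> ?H")
  proof (subst A(4), rule E.submodule_finsum)
    show "submodule ?H R ?E"
      by (rule E.preimage_submodule[OF ev module_axioms W(1)])
    show "(\<lambda>b. c b \<odot>\<^bsub>?E\<^esub> b) \<in> A \<rightarrow> ?H"
    proof
      fix b assume b: "b \<in> A"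
      then have bE: "b \<in> carrier ?E" and cb: "c b \<in> carrier R"
        using A CE by auto
      then have "b s \<in> carrier M"
        using sM by (auto simp: Hom_module_def mod_homD(1))
      then obtain a w where aw: "a \<in> carrier R" "w \<in> ?N" "p (b s) = a \<odot>\<^bsub>M\<^esub> s \<oplus>\<^bsub>M\<^esub> w"
        using pW by blast
      have wM: "w \<in> carrier M" using aw submoduleE(1)[OF N] by auto
      have "?ev (c b \<odot>\<^bsub>?E\<^esub> b) = c b \<odot>\<^bsub>M\<^esub> p (b s)"
        using mod_homD(3)[OF ev cb bE] bE by simp
      also have "\<dots> = (c b \<otimes>\<^bsub>R\<^esub> a) \<odot>\<^bsub>M\<^esub> s \<oplus>\<^bsub>M\<^esub> c b \<odot>\<^bsub>M\<^esub> w"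
        using aw cb sM wM by (simp add: smult_r_distr smult_assoc1)
      finally have "?ev (c b \<odot>\<^bsub>?E\<^esub> b) = (c b \<otimes>\<^bsub>R\<^esub> a) \<odot>\<^bsub>M\<^esub> s \<oplus>\<^bsub>M\<^esub> c b \<odot>\<^bsub>M\<^esub> w" .
      moreover have "c b \<otimes>\<^bsub>R\<^esub> a \<in> \<mm>" "c b \<odot>\<^bsub>M\<^esub> w \<in> ?N"
        using max.I_r_closed[OF c\<mm>[OF b] aw(1)] submoduleE(4)[OF N cb aw(2)] by auto
      ultimately have "?ev (c b \<odot>\<^bsub>?E\<^esub> b) \<in> ?W \<mm>"
        by blast
      then show "c b \<odot>\<^bsub>?E\<^esub> b \<in> ?H"
        using bE cb by simp
    qed
  qed (rule A(1))
  then have "p (p s) \<in> ?W \<mm>"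
    using pv by simp
  then obtain a w where "a \<in> \<mm>" "w \<in> ?N" "s = a \<odot>\<^bsub>M\<^esub> s \<oplus>\<^bsub>M\<^esub> w"
    using ps by auto
  then have "splitting p (G - {s}) B"
    using splitting_drop_generator[OF sp s] by blast
  then show thesis
    using that card_Diff1_less[OF G(1) s] by blast
qed

text \<open>The descent starts with the identity map, whose kernel has the empty basis. It ends with
  \<open>G\<close> empty, where \<open>p = 0\<close> and \<open>B\<close> is a basis of all of
  \<open>M\<close>.\<close>

lemma free_of_free_endomorphisms:
  assumes depth: "depth R \<le> 1" and refl: "reflexive_module R M"
    and fg: "finitely_generated_module R M" and E: "free_module R (End_module R M)"
  shows "free_module R M"
proof -
  have step: "free_module R M" if "splitting p G B" for p G B
    using that
  proof (induction "card G" arbitrary: p G B rule: less_induct)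
    case less
    show ?case
    proof (cases "G = {}")
      case True
      then have "p ` carrier M = {\<zero>\<^bsub>M\<^esub>}"
        using less.prems generated_submodule_empty by (simp add: splitting_def)
      then have "{m \<in> carrier M. p m = \<zero>\<^bsub>M\<^esub>} = carrier M"
        by auto
      then show ?thesis
        using less.prems by (auto simp: splitting_def free_module_def module_basis_def)
    next
      case False
      then show ?thesis
        using splitting_smaller[OF depth refl E less.prems] less.hyps by metis
    qed
  qed
  obtain S where S: "S \<subseteq> carrier M" "finite S" "generated_submodule R M S = carrier M"
    using fg by (auto simp: finitely_generated_module_def)
  have "(\<lambda>m\<in>carrier M. m) \<in> mod_hom R M M"
    by (rule mod_hom_restrictI) (auto simp: module_axioms)
  then have "splitting (\<lambda>m\<in>carrier M. m) S {}"
    using S by (auto simp: splitting_def linearly_independent_def generated_submodule_empty)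
  then show ?thesis
    by (rule step)
qed

end

theorem theorem4p2:
  fixes R :: "('a, 'r) ring_scheme" and M :: "('a, 'm, 'x) module_scheme"
  assumes "local_ring R" and "noetherian_ring R" and "depth R \<le> 1"
    and "module R M" and "finitely_generated_module R M" and "reflexive_module R M"
  shows "(has_free_summand R (End_module R M) \<longrightarrow> has_free_summand R M) \<and>
    (free_module R (End_module R M) \<longrightarrow> free_module R M)"
proof -
  interpret local_ring R by fact
  interpret noetherian_ring R by fact
  interpret module R M by fact
  interpret local_noetherian_module R M ..
  show ?thesis
    using free_summand_of_endomorphisms free_of_free_endomorphisms assms by blast
qed

end
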